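(* Let $\gamma$ be a closed geodesic on an orientable hyperbolic surface $M$. Then every triangle in $\mathbb{H}^2$ formed by geodesic lines above $\gamma$ has all its sides shorter than $l(\gamma)$, and, for $n\ge 3$, every convex $n$-gon in $\mathbb{H}^2$ formed by geodesic lines above $\gamma$ has all its sides shorter than $(n-2)\,l(\gamma)$.
   Context: A hyperbolic surface is a surface $M=\mathbb{H}^2/\pi_1(M)$ with $\pi_1(M)$ a discrete torsion-free group of isometries of $\mathbb{H}^2$. $l(\gamma)$ is the length of $\gamma$. A geodesic line above $\gamma$ is a complete geodesic line in $\mathbb{H}^2$ that is a component of the pre-image of $\gamma$. An $n$-gon formed by geodesic lines above $\gamma$ is a compact polygon in $\mathbb{H}^2$ with $n$ sides, each of which is a segment of a geodesic line above $\gamma$. *)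

theory Defs
  imports "HOL-Analysis.Analysis"
begin

section \<open>The hyperbolic plane (upper half-plane model)\<close>

typedef hyp_plane = "{z :: complex. Im z > 0}"
  morphisms coord of_coord
  by (rule exI[of _ \<i>]) simp

lemma Im_coord_pos: "Im (coord x) > 0"
  using coord[of x] by simp

definition cosh_dist :: "complex \<Rightarrow> complex \<Rightarrow> real" where
  "cosh_dist z w = 1 + (cmod (z - w))\<^sup>2 / (2 * Im z * Im w)"

lemma cosh_dist_ge_1: "Im z > 0 \<Longrightarrow> Im w > 0 \<Longrightarrow> cosh_dist z w \<ge> 1"
  by (simp add: cosh_dist_def)

lemma cosh_dist_commute: "cosh_dist z w = cosh_dist w z"
  by (simp add: cosh_dist_def norm_minus_commute mult_ac)

lemma cosh_dist_eq_1_iff: "Im z > 0 \<Longrightarrow> Im w > 0 \<Longrightarrow> cosh_dist z w = 1 \<longleftrightarrow> z = w"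
  by (simp add: cosh_dist_def)

lemma cosh_dist_gram:
  assumes "Im x > 0" "Im y > 0" "Im z > 0"
  shows "(cosh_dist x z - cosh_dist x y * cosh_dist y z)\<^sup>2
    \<le> ((cosh_dist x y)\<^sup>2 - 1) * ((cosh_dist y z)\<^sup>2 - 1)"
proof -
  define a b c p q r where defs: "a = Re x" "b = Re y" "c = Re z" "p = Im x" "q = Im y" "r = Im z"
  have pos: "p > 0" "q > 0" "r > 0"
    using assms by (auto simp: defs)
  have form: "cosh_dist u v = ((Re u - Re v)\<^sup>2 + (Im u)\<^sup>2 + (Im v)\<^sup>2) / (2 * Im u * Im v)"
    if "Im u > 0" "Im v > 0" for u v
    unfolding cosh_dist_def cmod_power2 using that by (simp add: field_simps power2_eq_square)
  define A where "A = (a - b)\<^sup>2 + p\<^sup>2 + q\<^sup>2"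
  define B where "B = (b - c)\<^sup>2 + q\<^sup>2 + r\<^sup>2"
  define C where "C = (a - c)\<^sup>2 + p\<^sup>2 + r\<^sup>2"
  define D where "D = a * (b\<^sup>2 + q\<^sup>2 - c\<^sup>2 - r\<^sup>2) + b * (c\<^sup>2 + r\<^sup>2 - a\<^sup>2 - p\<^sup>2) + c * (a\<^sup>2 + p\<^sup>2 - b\<^sup>2 - q\<^sup>2)"
  have eqs: "cosh_dist x y = A / (2 * p * q)" "cosh_dist y z = B / (2 * q * r)"
    "cosh_dist x z = C / (2 * p * r)"
    using assms by (auto simp: form A_def B_def C_def defs)
  have poly: "(A\<^sup>2 - 4 * p\<^sup>2 * q\<^sup>2) * (B\<^sup>2 - 4 * q\<^sup>2 * r\<^sup>2) - (2 * q\<^sup>2 * C - A * B)\<^sup>2 = 4 * q\<^sup>2 * D\<^sup>2"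
    unfolding A_def B_def C_def D_def by algebra
  have "((A / (2 * p * q))\<^sup>2 - 1) * ((B / (2 * q * r))\<^sup>2 - 1)
      - (C / (2 * p * r) - A / (2 * p * q) * (B / (2 * q * r)))\<^sup>2
      = ((A\<^sup>2 - 4 * p\<^sup>2 * q\<^sup>2) * (B\<^sup>2 - 4 * q\<^sup>2 * r\<^sup>2) - (2 * q\<^sup>2 * C - A * B)\<^sup>2) / (16 * p\<^sup>2 * q\<^sup>2 * q\<^sup>2 * r\<^sup>2)"
    using pos by (simp add: divide_simps power2_eq_square) algebra
  also have "\<dots> \<ge> 0"
    unfolding poly by simp
  finally show ?thesis
    by (simp add: eqs)
qed

instantiation hyp_plane :: metric_space
begin

definition dist_hyp_plane :: "hyp_plane \<Rightarrow> hyp_plane \<Rightarrow> real" where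
  "dist x y = arcosh (cosh_dist (coord x) (coord y))"

definition uniformity_hyp_plane :: "(hyp_plane \<times> hyp_plane) filter" where
  "uniformity_hyp_plane = (INF e\<in>{0 <..}. principal {(x, y). dist x y < e})"

definition open_hyp_plane :: "hyp_plane set \<Rightarrow> bool" where
  "open_hyp_plane U = (\<forall>x\<in>U. eventually (\<lambda>(x', y). x' = x \<longrightarrow> y \<in> U) uniformity)"

instance
proof
  show "uniformity = (INF e\<in>{0 <..}. principal {(x :: hyp_plane, y). dist x y < e})"
    by (rule uniformity_hyp_plane_def)
  show "open U = (\<forall>x\<in>U. eventually (\<lambda>(x', y). x' = x \<longrightarrow> y \<in> U) uniformity)"
    for U :: "hyp_plane set"
    by (rule open_hyp_plane_def)
  show "dist x y = 0 \<longleftrightarrow> x = y" for x y :: hyp_plane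
    by (simp add: dist_hyp_plane_def Im_coord_pos cosh_dist_ge_1 cosh_dist_eq_1_iff coord_inject)
  show "dist x y \<le> dist x z + dist y z" for x y z :: hyp_plane
  proof -
    define a where "a = cosh_dist (coord x) (coord z)"
    define b where "b = cosh_dist (coord z) (coord y)"
    define c where "c = cosh_dist (coord x) (coord y)"
    have ge1: "a \<ge> 1" "b \<ge> 1" "c \<ge> 1"
      by (simp_all add: a_def b_def c_def cosh_dist_ge_1 Im_coord_pos)
    have "(c - a * b)\<^sup>2 \<le> (a\<^sup>2 - 1) * (b\<^sup>2 - 1)"
      unfolding a_def b_def c_def by (intro cosh_dist_gram Im_coord_pos)
    hence "c - a * b \<le> sqrt (a\<^sup>2 - 1) * sqrt (b\<^sup>2 - 1)"
      by (metis real_le_rsqrt real_sqrt_mult)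
    hence "c \<le> cosh (arcosh a + arcosh b)"
      using ge1 by (simp add: cosh_add sinh_arcosh_real)
    hence "arcosh c \<le> arcosh (cosh (arcosh a + arcosh b))"
      using ge1 arcosh_less_iff_real[of "cosh (arcosh a + arcosh b)" c] cosh_real_ge_1
      by (meson not_less)
    also have "\<dots> = arcosh a + arcosh b"
      using ge1 by (intro arcosh_cosh_real) simp
    finally show ?thesis
      by (simp add: dist_hyp_plane_def a_def b_def c_def cosh_dist_commute)
  qed
qed

end

definition geodesic_param :: "(real \<Rightarrow> hyp_plane) \<Rightarrow> bool" where
  "geodesic_param \<alpha> \<longleftrightarrow> (\<forall>s t. dist (\<alpha> s) (\<alpha> t) = \<bar>s - t\<bar>)"

definition geodesic_line :: "hyp_plane set \<Rightarrow> bool" where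
  "geodesic_line \<Lambda> \<longleftrightarrow> (\<exists>\<alpha>. geodesic_param \<alpha> \<and> \<Lambda> = range \<alpha>)"

definition geodesic_segment :: "hyp_plane \<Rightarrow> hyp_plane \<Rightarrow> hyp_plane set" where
  "geodesic_segment x y = {z. dist x z + dist z y = dist x y}"

definition geodesically_convex :: "hyp_plane set \<Rightarrow> bool" where
  "geodesically_convex P \<longleftrightarrow> (\<forall>x\<in>P. \<forall>y\<in>P. geodesic_segment x y \<subseteq> P)"


section \<open>Hyperbolic surfaces\<close>

definition hyp_isometry :: "(hyp_plane \<Rightarrow> hyp_plane) \<Rightarrow> bool" where
  "hyp_isometry f \<longleftrightarrow> bij f \<and> (\<forall>x y. dist (f x) (f y) = dist x y)"

text \<open>
  Positive Jacobian determinant in the coordinate of the upper half-plane: for a real-linear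
  \<open>D : \<complex> \<rightarrow> \<complex>\<close>, the number \<open>Im (cnj (D 1) * D \<i>)\<close> is its determinant
  with respect to the basis \<open>1, \<i>\<close>.
\<close>
definition orientation_preserving :: "(hyp_plane \<Rightarrow> hyp_plane) \<Rightarrow> bool" where
  "orientation_preserving f \<longleftrightarrow>
     (\<forall>x. \<exists>D. ((\<lambda>z. coord (f (of_coord z))) has_derivative D) (at (coord x)) \<and>
          Im (cnj (D 1) * D \<i>) > 0)"

text \<open>
  The group \<open>\<Gamma> = \<pi>\<^sub>1(M)\<close> of a hyperbolic surface \<open>M = \<H>/\<Gamma>\<close>. The constant \<open>discrete\<close> refers to
  the topology of pointwise convergence on functions \<open>hyp_plane \<Rightarrow> hyp_plane\<close>, which on the
  isometry group is the usual (Lie group, or compact-open) topology.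
\<close>
definition surface_group :: "(hyp_plane \<Rightarrow> hyp_plane) set \<Rightarrow> bool" where
  "surface_group \<Gamma> \<longleftrightarrow>
     (\<forall>g\<in>\<Gamma>. hyp_isometry g) \<and>
     id \<in> \<Gamma> \<and> (\<forall>g\<in>\<Gamma>. \<forall>h\<in>\<Gamma>. g \<circ> h \<in> \<Gamma>) \<and> (\<forall>g\<in>\<Gamma>. inv g \<in> \<Gamma>) \<and>
     discrete \<Gamma> \<and>
     (\<forall>g\<in>\<Gamma>. \<forall>n>0. g ^^ n = id \<longrightarrow> g = id)"

text \<open>
  An orientation of \<open>M = \<H>/\<Gamma>\<close> is the same thing as a \<open>\<Gamma>\<close>-invariant orientation of \<open>\<H>\<close>.
\<close>
definition orientable_quotient :: "(hyp_plane \<Rightarrow> hyp_plane) set \<Rightarrow> bool" where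
  "orientable_quotient \<Gamma> \<longleftrightarrow> (\<forall>g\<in>\<Gamma>. orientation_preserving g)"

text \<open>Points of \<open>M\<close> are the \<open>\<Gamma>\<close>-orbits.\<close>
definition covering_proj :: "(hyp_plane \<Rightarrow> hyp_plane) set \<Rightarrow> hyp_plane \<Rightarrow> hyp_plane set" where
  "covering_proj \<Gamma> x = (\<lambda>g. g x) ` \<Gamma>"

text \<open>
  A closed geodesic of length \<open>l\<close> is given by a parametrisation \<open>\<gamma> : \<real> \<rightarrow> M\<close> by arc length that is
  \<open>l\<close>-periodic. Since the metric of \<open>M\<close> makes the covering projection a local isometry, \<open>\<gamma>\<close> is a
  geodesic iff it is locally the projection of a geodesic of \<open>\<H>\<close>. The period \<open>l\<close> need not be
  the minimal one: closed geodesics may be multiply traversed.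
\<close>
definition closed_geodesic ::
    "(hyp_plane \<Rightarrow> hyp_plane) set \<Rightarrow> real \<Rightarrow> (real \<Rightarrow> hyp_plane set) \<Rightarrow> bool" where
  "closed_geodesic \<Gamma> l \<gamma> \<longleftrightarrow>
     l > 0 \<and> (\<forall>t. \<gamma> (t + l) = \<gamma> t) \<and>
     (\<forall>t. \<exists>e>0. \<exists>\<alpha>. geodesic_param \<alpha> \<and> (\<forall>s. \<bar>s - t\<bar> < e \<longrightarrow> \<gamma> s = covering_proj \<Gamma> (\<alpha> s)))"

text \<open>
  Where \<open>\<gamma>\<close> crosses itself, the lines above it cross, so they are not topological components of the
  subset \<open>covering_proj \<Gamma> -` range \<gamma>\<close>; a component of the pre-image is, as usual in covering
  space theory, the image of a complete lift of \<open>\<gamma>\<close>.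
\<close>
definition line_above ::
    "(hyp_plane \<Rightarrow> hyp_plane) set \<Rightarrow> (real \<Rightarrow> hyp_plane set) \<Rightarrow> hyp_plane set \<Rightarrow> bool" where
  "line_above \<Gamma> \<gamma> \<Lambda> \<longleftrightarrow>
     (\<exists>\<alpha>. geodesic_param \<alpha> \<and> (\<forall>t. covering_proj \<Gamma> (\<alpha> t) = \<gamma> t) \<and> \<Lambda> = range \<alpha>)"


section \<open>Polygons\<close>

definition polygon_side :: "nat \<Rightarrow> (nat \<Rightarrow> hyp_plane) \<Rightarrow> nat \<Rightarrow> hyp_plane set" where
  "polygon_side n v i = geodesic_segment (v i) (v (Suc i mod n))"

definition side_length :: "nat \<Rightarrow> (nat \<Rightarrow> hyp_plane) \<Rightarrow> nat \<Rightarrow> real" where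
  "side_length n v i = dist (v i) (v (Suc i mod n))"

text \<open>
  \<open>P\<close> is a compact \<open>n\<close>-gon with vertices \<open>v 0, \<dots>, v (n - 1)\<close> in cyclic order: the sides form a
  simple closed curve, consecutive sides do not lie on a common geodesic line (so that there are
  really \<open>n\<close> sides), and \<open>P\<close> is the compact region bounded by this curve. The condition on
  \<open>interior P\<close> excludes the curve itself.
\<close>
definition polygon :: "nat \<Rightarrow> (nat \<Rightarrow> hyp_plane) \<Rightarrow> hyp_plane set \<Rightarrow> bool" where
  "polygon n v P \<longleftrightarrow>
     n \<ge> 3 \<and> inj_on v {..<n} \<and>
     (\<forall>i<n. polygon_side n v i \<inter> polygon_side n v (Suc i mod n) = {v (Suc i mod n)}) \<and>
     (\<forall>i<n. \<forall>j<n. j \<noteq> i \<and> j \<noteq> Suc i mod n \<and> i \<noteq> Suc j mod n \<longrightarrow>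
        polygon_side n v i \<inter> polygon_side n v j = {}) \<and>
     (\<forall>i<n. \<not> (\<exists>\<Lambda>. geodesic_line \<Lambda> \<and>
        polygon_side n v i \<union> polygon_side n v (Suc i mod n) \<subseteq> \<Lambda>)) \<and>
     compact P \<and> interior P \<noteq> {} \<and> frontier P = (\<Union>i<n. polygon_side n v i)"

definition polygon_formed_by_lines_above ::
    "(hyp_plane \<Rightarrow> hyp_plane) set \<Rightarrow> (real \<Rightarrow> hyp_plane set) \<Rightarrow>
     nat \<Rightarrow> (nat \<Rightarrow> hyp_plane) \<Rightarrow> hyp_plane set \<Rightarrow> bool" where
  "polygon_formed_by_lines_above \<Gamma> \<gamma> n v P \<longleftrightarrow>
     polygon n v P \<and> (\<forall>i<n. \<exists>\<Lambda>. line_above \<Gamma> \<gamma> \<Lambda> \<and> polygon_side n v i \<subseteq> \<Lambda>)"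

end

theory Submission
  imports Defs
begin

text \<open>
  Let \<open>\<Lambda>\<close> be a line above \<open>\<gamma>\<close>. The key claim is that the orthogonal projection to \<open>\<Lambda>\<close> of any other line
  above \<open>\<gamma>\<close> has length less than \<open>l\<close>. If the two lines cross, then the crossing point is the midpoint of
  the projection. The projections of the other sides of a polygon cover the side on \<open>\<Lambda>\<close>; the two adjacent
  ones contribute less than \<open>l/2\<close> each and the other \<open>n - 3\<close> less than \<open>l\<close> each. Convexity is only needed to
  exclude two sides on the same line.

  For the claim, normalise \<open>\<Lambda>\<close> to the imaginary axis, so that \<open>a = diag (exp (l/2), exp (- l/2))\<close> lies in the group.
  The other line is the image of \<open>\<Lambda>\<close> under a group element \<open>g = (p, q; r, s)\<close>, and its projection has
  length \<open>\<bar>ln \<bar>p s / (q r)\<bar>\<bar>\<close>. If \<open>p s\<close> is small, some \<open>g a\<^sup>j\<close> is elliptic. If \<open>q r\<close> is small, the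
  commutator of \<open>g\<close> and \<open>a\<close> has trace \<open>\<kappa>\<close> close to \<open>2\<close>. For \<open>\<kappa> < 2\<close> it is elliptic, \<open>\<kappa> = 2\<close> contradicts
  discreteness, and for \<open>\<kappa> > 2\<close> one replaces the largest \<open>Z\<close> of the traces \<open>X, Y, Z\<close> of \<open>g, a, g a\<close> by
  \<open>X Y - Z\<close>, again and again: without elliptic elements all traces stay at least \<open>2\<close>, while the sum
  decreases by at least \<open>2 sqrt (\<kappa> - 2)\<close> each time.
\<close>

section \<open>Groups of matrices without elliptic elements\<close>

text \<open>By Fricke's identity \<open>\<kappa>\<close> is the trace of the commutator of two matrices of traces \<open>X\<close>, \<open>Y\<close> and
  trace \<open>Z\<close> of the product. The value \<open>18\<close> is the minimum of \<open>\<kappa>\<close> when \<open>Z \<le> - 2\<close>.\<close>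
lemma trace_flip:
  fixes X Y Z :: real
  assumes "2 \<le> X" "2 \<le> Y" "X \<le> Z" "Y \<le> Z"
    and "\<bar>X * Y - Z\<bar> \<ge> 2"
    and \<kappa>: "\<kappa> = X\<^sup>2 + Y\<^sup>2 + Z\<^sup>2 - X * Y * Z - 2" "2 < \<kappa>" "\<kappa> < 18"
  shows "2 \<le> X * Y - Z" and "X * Y - Z + 2 * sqrt (\<kappa> - 2) \<le> Z"
proof -
  show 1: "2 \<le> X * Y - Z"
  proof (rule ccontr)
    assume "\<not> ?thesis"
    hence "Z - X * Y \<ge> 2" using assms by linarith
    define W where "W = Z - X * Y"
    have W: "W \<ge> 2" using \<open>Z - X * Y \<ge> 2\<close> W_def by simp
    have "\<kappa> = X\<^sup>2 + Y\<^sup>2 + W\<^sup>2 + X * Y * W - 2"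
      unfolding \<kappa> W_def by algebra
    moreover have "X\<^sup>2 \<ge> 4" "Y\<^sup>2 \<ge> 4" "W\<^sup>2 \<ge> 4"
      using assms W power_mono[of 2 _ 2] by fastforce+
    moreover have "X * Y \<ge> 4" using mult_mono[of 2 X 2 Y] assms by simp
    hence "X * Y * W \<ge> 8" using mult_mono[of 4 "X*Y" 2 W] W by simp
    ultimately show False using \<kappa> by linarith
  qed
  \<comment> \<open>For fixed \<open>X\<close> and \<open>Y\<close> the equation for
    \<open>\<kappa>\<close> is quadratic with roots \<open>Z\<close> and \<open>X * Y - Z\<close>;
    the squared difference of the roots is the discriminant.\<close>
  have disc: "(2 * Z - X * Y)\<^sup>2 = (X\<^sup>2 - 4) * (Y\<^sup>2 - 4) + 4 * (\<kappa> - 2)"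
    unfolding \<kappa> by algebra
  have "X\<^sup>2 \<ge> 4" "Y\<^sup>2 \<ge> 4"
    using assms power_mono[of 2 _ 2] by fastforce+
  hence ge: "(2 * Z - X * Y)\<^sup>2 \<ge> 4 * (\<kappa> - 2)" by (simp add: disc)
  have pos: "2 * Z - X * Y > 0"
  proof (rule ccontr)
    assume neg: "\<not> ?thesis"
    \<comment> \<open>Otherwise \<open>Z\<close> lies between \<open>b\<close> and the vertex
      \<open>a * b / 2\<close>, where the quadratic decreases, so \<open>\<kappa>\<close> is at most
      its value at \<open>b\<close>, which equals
      \<open>2 - (a - 2) * (b\<^sup>2 - a - 2)\<close>.\<close>
    have *: False if h: "2 \<le> a" "a \<le> b" "b \<le> Z" "2 * Z \<le> a * b" 
      "\<kappa> = a\<^sup>2 + b\<^sup>2 + Z\<^sup>2 - a * b * Z - 2" for a b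
    proof -
      have "(Z - b) * (a * b - Z - b) \<ge> 0"
        using h by (intro mult_nonneg_nonneg) auto
      hence 1: "\<kappa> \<le> a\<^sup>2 + b\<^sup>2 + b\<^sup>2 - a * b * b - 2"
        unfolding h(5) by (simp add: algebra_simps power2_eq_square)
      have "(a - 2) * (b\<^sup>2 - a - 2) \<ge> 0"
      proof -
        have "b\<^sup>2 \<ge> a\<^sup>2" using h by (intro power_mono) auto
        moreover have "a\<^sup>2 \<ge> 2 * a" using h by (simp add: power2_eq_square)
        ultimately have "b\<^sup>2 - a - 2 \<ge> 0" using h by linarith
        thus ?thesis using h by (intro mult_nonneg_nonneg) auto
      qed
      hence "a\<^sup>2 + b\<^sup>2 + b\<^sup>2 - a * b * b - 2 \<le> 2"
        by (simp add: algebra_simps power2_eq_square)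
      thus False using 1 \<kappa> by linarith
    qed
    show False
    proof (cases "X \<le> Y")
      case True
      thus ?thesis using *[of X Y] assms neg by linarith
    next
      case False
      thus ?thesis using *[of Y X] assms neg by (simp add: mult.commute add.commute)
    qed
  qed
  have "sqrt (4 * (\<kappa> - 2)) \<le> 2 * Z - X * Y"
    using ge pos by (intro real_le_lsqrt) auto
  moreover have "sqrt (4 * (\<kappa> - 2)) = 2 * sqrt (\<kappa> - 2)"
    unfolding real_sqrt_mult by simp
  ultimately show "X * Y - Z + 2 * sqrt (\<kappa> - 2) \<le> Z" by linarith
qed

text \<open>Infinite descent. The symmetries of \<open>T\<close> move the largest entry to the last
  place, where a flip lowers the sum by at least a fixed amount and keeps all entries at least
  \<open>2\<close>; but the sum cannot fall below \<open>6\<close>.\<close>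

lemma trace_descent:
  fixes T :: "real \<Rightarrow> real \<Rightarrow> real \<Rightarrow> bool"
  assumes swap: "\<And>X Y Z. T X Y Z \<Longrightarrow> T Y X Z" "\<And>X Y Z. T X Y Z \<Longrightarrow> T X Z Y"
    and flip: "\<And>X Y Z. T X Y Z \<Longrightarrow> T X Y (X * Y - Z)"
    and large: "\<And>X Y Z. T X Y Z \<Longrightarrow> \<bar>Z\<bar> \<ge> 2"
    and \<kappa>: "2 < \<kappa>" "\<kappa> < 18"
  shows "T X Y Z \<Longrightarrow> 2 \<le> X \<Longrightarrow> 2 \<le> Y \<Longrightarrow> 2 \<le> Z \<Longrightarrow>
    X\<^sup>2 + Y\<^sup>2 + Z\<^sup>2 - X * Y * Z - 2 \<noteq> \<kappa>"
proof -
  define \<delta> where "\<delta> = 2 * sqrt (\<kappa> - 2)"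
  have \<delta>: "\<delta> > 0" using \<kappa> by (simp add: \<delta>_def)
  \<comment> \<open>\<open>N\<close> bounds the number of flips possible before the sum would drop
    below \<open>6\<close>.\<close>
  have main: "X\<^sup>2 + Y\<^sup>2 + Z\<^sup>2 - X * Y * Z - 2 \<noteq> \<kappa>"
    if "T X Y Z" "2 \<le> X" "2 \<le> Y" "2 \<le> Z" "X + Y + Z < 6 + real N * \<delta>" for X Y Z N
    using that
  proof (induction N arbitrary: X Y Z)
    case 0
    thus ?case by simp
  next
    case (Suc N)
    have step: "X\<^sup>2 + Y\<^sup>2 + Z\<^sup>2 - X * Y * Z - 2 \<noteq> \<kappa>"
      if h: "T X Y Z" "2 \<le> X" "2 \<le> Y" "2 \<le> Z" "X + Y + Z < 6 + real (Suc N) * \<delta>"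
        "X \<le> Z" "Y \<le> Z" for X Y Z
    proof
      assume e: "X\<^sup>2 + Y\<^sup>2 + Z\<^sup>2 - X * Y * Z - 2 = \<kappa>"
      have "\<bar>X * Y - Z\<bar> \<ge> 2" using large flip h(1) by blast
      note f = trace_flip[OF h(2,3,6,7) this e[symmetric] \<kappa>]
      have "X\<^sup>2 + Y\<^sup>2 + (X * Y - Z)\<^sup>2 - X * Y * (X * Y - Z) - 2 = \<kappa>"
        unfolding e[symmetric] by algebra
      moreover have "X + Y + (X * Y - Z) < 6 + real N * \<delta>"
        using f(2) h(5) unfolding \<delta>_def[symmetric] by (simp add: algebra_simps)
      ultimately show False using Suc.IH[OF flip[OF h(1)] h(2,3) f(1)] by blast
    qed
    note p = Suc.prems
    consider "X \<le> Z" "Y \<le> Z" | "X \<le> Y" "Z \<le> Y" | "Y \<le> X" "Z \<le> X" by linarith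
    thus ?case
    proof cases
      case 1
      thus ?thesis using step[OF p] by simp
    next
      case 2
      thus ?thesis using step[of X Z Y] p swap(2)[OF p(1)]
        by (simp add: algebra_simps)
    next
      case 3
      thus ?thesis using step[of Y Z X] p swap(2)[OF swap(1)[OF p(1)]]
        by (simp add: algebra_simps)
    qed
  qed
  show "T X Y Z \<Longrightarrow> 2 \<le> X \<Longrightarrow> 2 \<le> Y \<Longrightarrow> 2 \<le> Z \<Longrightarrow>
    X\<^sup>2 + Y\<^sup>2 + Z\<^sup>2 - X * Y * Z - 2 \<noteq> \<kappa>"
  proof -
    obtain N where "X + Y + Z - 6 < real N * \<delta>"
      using reals_Archimedean3[OF \<delta>] by blast
    thus "T X Y Z \<Longrightarrow> 2 \<le> X \<Longrightarrow> 2 \<le> Y \<Longrightarrow> 2 \<le> Z \<Longrightarrow>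
      X\<^sup>2 + Y\<^sup>2 + Z\<^sup>2 - X * Y * Z - 2 \<noteq> \<kappa>" 
      using main[of X Y Z N] by linarith
  qed
qed

section \<open>Discrete subgroups of SL(2, R) in coordinates\<close>

type_synonym mat2 = "real \<times> real \<times> real \<times> real"

fun mmul :: "mat2 \<Rightarrow> mat2 \<Rightarrow> mat2" (infixl "\<odot>" 70) where
  "(a, b, c, d) \<odot> (a', b', c', d') = (a * a' + b * c', a * b' + b * d', c * a' + d * c', c * b' + d * d')"

fun madj :: "mat2 \<Rightarrow> mat2" where
  "madj (a, b, c, d) = (d, - b, - c, a)"

fun mtrace :: "mat2 \<Rightarrow> real" where
  "mtrace (a, b, c, d) = a + d"

fun mdet :: "mat2 \<Rightarrow> real" where
  "mdet (a, b, c, d) = a * d - b * c"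

definition mone :: mat2 where
  "mone = (1, 0, 0, 1)"

lemma mmul_assoc: "A \<odot> B \<odot> C = A \<odot> (B \<odot> C)"
  by (cases A; cases B; cases C) (simp add: algebra_simps)

lemma mone_mmul [simp]: "mone \<odot> A = A" "A \<odot> mone = A"
  by (cases A; simp add: mone_def)+

lemma madj_mmul [simp]:
  assumes "mdet A = 1"
  shows "madj A \<odot> A = mone" "A \<odot> madj A = mone"
  using assms by (cases A; simp add: mone_def algebra_simps)+

lemma mdet_mmul [simp]: "mdet (A \<odot> B) = mdet A * mdet B"
  by (cases A; cases B) (simp add: algebra_simps)

lemma mdet_madj [simp]: "mdet (madj A) = mdet A"
  by (cases A) (simp add: algebra_simps)

lemma mdet_uminus [simp]: "mdet (- A) = mdet A"
  by (cases A) simp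

lemma mdet_mone [simp]: "mdet mone = 1"
  by (simp add: mone_def)

lemma madj_madj [simp]: "madj (madj A) = A"
  by (cases A) simp

lemma mtrace_commute: "mtrace (A \<odot> B) = mtrace (B \<odot> A)"
  by (cases A; cases B) (simp add: algebra_simps)

lemma mtrace_madj [simp]: "mtrace (madj A) = mtrace A"
  by (cases A) simp

lemma mtrace_mmul_madj: "mtrace (A \<odot> madj B) = mtrace A * mtrace B - mtrace (A \<odot> B)"
  by (cases A; cases B) (simp add: algebra_simps)

definition diag :: "real \<Rightarrow> mat2" where
  "diag t = (exp (t / 2), 0, 0, exp (- (t / 2)))"

lemma diag_mmul: "diag s \<odot> diag t = diag (s + t)"
  by (simp add: diag_def add_divide_distrib flip: exp_add)

lemma diag_0 [simp]: "diag 0 = mone"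
  by (simp add: diag_def mone_def)

lemma madj_diag [simp]: "madj (diag t) = diag (- t)"
  by (simp add: diag_def)

lemma mdet_diag [simp]: "mdet (diag t) = 1"
  by (simp add: diag_def flip: exp_add)

text \<open>An isometry determines its matrix only up to sign, hence the closure under negation.
  \<open>trace\<close> excludes elliptic elements, and \<open>isolated\<close> is discreteness at
  the identity.\<close>

locale sl2_subgroup =
  fixes G :: "mat2 set"
  assumes det: "A \<in> G \<Longrightarrow> mdet A = 1"
    and mul: "A \<in> G \<Longrightarrow> B \<in> G \<Longrightarrow> A \<odot> B \<in> G"
    and adj: "A \<in> G \<Longrightarrow> madj A \<in> G"
    and neg: "A \<in> G \<Longrightarrow> - A \<in> G"
    and trace: "A \<in> G \<Longrightarrow> \<bar>mtrace A\<bar> \<ge> 2"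
    and isolated: "\<exists>e>0. \<forall>A\<in>G. dist A mone < e \<longrightarrow> A = mone"
begin

text \<open>The descent is applied to the trace triples of all pairs in \<open>G\<close>: passing
  from \<open>A, B\<close> to \<open>madj A, A \<odot> B\<close> exchanges the last two traces, and
  inverting \<open>B\<close> flips the last one.\<close>

lemma no_small_commutator:
  assumes "A \<in> G" "B \<in> G" "2 \<le> mtrace A" "2 \<le> mtrace B" "2 \<le> mtrace (A \<odot> B)"
    and "2 < (mtrace A)\<^sup>2 + (mtrace B)\<^sup>2 + (mtrace (A \<odot> B))\<^sup>2 - mtrace A * mtrace B * mtrace (A \<odot> B) - 2"
    and "(mtrace A)\<^sup>2 + (mtrace B)\<^sup>2 + (mtrace (A \<odot> B))\<^sup>2 - mtrace A * mtrace B * mtrace (A \<odot> B) - 2 < 18"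
  shows False
proof -
  define T where "T X Y Z \<longleftrightarrow> (\<exists>A\<in>G. \<exists>B\<in>G. X = mtrace A \<and> Y = mtrace B \<and> Z = mtrace (A \<odot> B))" for X Y Z
  have "T Y X Z" if "T X Y Z" for X Y Z
    using that mtrace_commute unfolding T_def by blast
  moreover have "T X Z Y" if "T X Y Z" for X Y Z
  proof -
    obtain A B where *: "A \<in> G" "B \<in> G" "X = mtrace A" "Y = mtrace B" "Z = mtrace (A \<odot> B)"
      using \<open>T X Y Z\<close> unfolding T_def by blast
    have "madj A \<odot> (A \<odot> B) = B"
      using det[OF *(1)] by (simp flip: mmul_assoc)
    thus ?thesis unfolding T_def
      using * adj[of A] mul[of A B] by (intro bexI[of _ "madj A"] bexI[of _ "A \<odot> B"]) auto
  qed
  moreover have "T X Y (X * Y - Z)" if "T X Y Z" for X Y Z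
  proof -
    obtain A B where *: "A \<in> G" "B \<in> G" "X = mtrace A" "Y = mtrace B" "Z = mtrace (A \<odot> B)"
      using \<open>T X Y Z\<close> unfolding T_def by blast
    thus ?thesis unfolding T_def
      using adj[of B] by (intro bexI[of _ A] bexI[of _ "madj B"]) (auto simp: mtrace_mmul_madj)
  qed
  moreover have "\<bar>Z\<bar> \<ge> 2" if "T X Y Z" for X Y Z
    using that trace mul unfolding T_def by blast
  moreover have "T (mtrace A) (mtrace B) (mtrace (A \<odot> B))"
    unfolding T_def using assms(1,2) by blast
  ultimately show False
    using trace_descent[of T, OF _ _ _ _ assms(6,7)] assms(3-5) by metis
qed

lemma diag_of_int_mult:
  assumes "diag l \<in> G"
  shows "diag (of_int j * l) \<in> G"
proof -
  have nat: "diag (of_nat n * t) \<in> G" if "diag t \<in> G" for n :: nat and t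
  proof (induction n)
    case 0
    have "diag t \<odot> madj (diag t) \<in> G" using mul adj that by blast
    thus ?case by (simp add: diag_mmul)
  next
    case (Suc n)
    have "diag t \<odot> diag (of_nat n * t) \<in> G" using mul that Suc by blast
    thus ?case by (simp add: diag_mmul algebra_simps)
  qed
  show ?thesis
  proof (cases "j \<ge> 0")
    case True
    thus ?thesis using nat[OF assms, of "nat j"] by simp
  next
    case False
    have "diag (- l) \<in> G" using adj[OF assms] by simp
    from nat[OF this, of "nat (- j)"] False show ?thesis by simp
  qed
qed

text \<open>Conjugation by powers of the hyperbolic element contracts a unipotent element to the identity.\<close>
lemma no_unipotent:
  assumes "diag l \<in> G" "l > 0" "(1, u, 0, 1) \<in> G \<or> (1, 0, u, 1) \<in> G"
  shows "u = 0"
proof (rule ccontr)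
  assume u: "u \<noteq> 0"
  obtain e where e: "e > 0" "\<And>A. A \<in> G \<Longrightarrow> dist A mone < e \<Longrightarrow> A = mone"
    using isolated by blast
  define w where "w n = u * exp (- l) ^ n" for n
  have w: "w n = u * exp (- (real n * l))" for n
    by (simp add: w_def flip: exp_of_nat_mult)
  have lim: "w \<longlonglongrightarrow> u * 0"
    unfolding w_def using assms(2) by (intro tendsto_intros LIMSEQ_power_zero) simp
  have m: "diag (real n * l) \<in> G" "diag (- (real n * l)) \<in> G" for n
    using diag_of_int_mult[OF assms(1), of "int n"] diag_of_int_mult[OF assms(1), of "- int n"] by simp_all
  have ex: "exp (x / 2) * exp (x / 2) = exp x" "exp (x / 2) * exp (- x / 2) = 1" for x :: real
    by (simp_all flip: exp_add)
  from assms(3) show False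
  proof
    assume U: "(1, u, 0, 1) \<in> G"
    have "(1, w n, 0, 1) \<in> G" for n
    proof -
      have "diag (- (real n * l)) \<odot> (1, u, 0, 1) \<odot> diag (real n * l) \<in> G"
        using m U mul by blast
      moreover have "diag (- (real n * l)) \<odot> (1, u, 0, 1) \<odot> diag (real n * l) = (1, w n, 0, 1)"
        using ex[of "- (real n * l)"] by (simp add: diag_def w mult_ac)
      ultimately show ?thesis by simp
    qed
    moreover have "(\<lambda>n. (1, w n, 0, 1)) \<longlonglongrightarrow> mone"
      unfolding mone_def using lim by (intro tendsto_Pair tendsto_const) simp
    hence "\<forall>\<^sub>F n in sequentially. dist (1, w n, 0, 1) mone < e"
      using e(1) by (rule tendstoD)
    then obtain n where "dist (1, w n, 0, 1) mone < e"
      using eventually_happens'[OF sequentially_bot] by blast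
    ultimately have "(1, w n, 0, 1) = mone" using e(2) by blast
    thus False using u by (simp add: mone_def w)
  next
    assume U: "(1, 0, u, 1) \<in> G"
    \<comment> \<open>Lower triangular elements contract under the opposite powers.\<close>
    have "(1, 0, w n, 1) \<in> G" for n
    proof -
      have "diag (real n * l) \<odot> (1, 0, u, 1) \<odot> diag (- (real n * l)) \<in> G"
        using m U mul by blast
      moreover have "diag (real n * l) \<odot> (1, 0, u, 1) \<odot> diag (- (real n * l)) = (1, 0, w n, 1)"
        using ex[of "- (real n * l)"] by (simp add: diag_def w mult_ac)
      ultimately show ?thesis by simp
    qed
    moreover have "(\<lambda>n. (1, 0, w n, 1)) \<longlonglongrightarrow> mone"
      unfolding mone_def using lim by (intro tendsto_Pair tendsto_const) simp
    hence "\<forall>\<^sub>F n in sequentially. dist (1, 0, w n, 1) mone < e"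
      using e(1) by (rule tendstoD)
    then obtain n where "dist (1, 0, w n, 1) mone < e"
      using eventually_happens'[OF sequentially_bot] by blast
    ultimately have "(1, 0, w n, 1) = mone" using e(2) by blast
    thus False using u by (simp add: mone_def w)
  qed
qed


text \<open>If the diagonal entries of \<open>A\<close> are small compared to \<open>exp l\<close>, then some \<open>A \<odot> diag (j * l)\<close>
  is elliptic.\<close>
lemma diagonal_lower_bound:
  assumes "diag l \<in> G" "l > 0" "(p, q, r, s) \<in> G"
  shows "\<bar>q * r\<bar> < exp l * \<bar>p * s\<bar>"
proof (rule ccontr)
  assume neg: "\<not> ?thesis"
  have dt: "p * s - q * r = 1" using det[OF assms(3)] by simp
  define E where "E = exp l"
  have E: "E > 1" using assms(2) by (simp add: E_def)
  have tr: "\<bar>p * exp (of_int j * l / 2) + s * exp (- (of_int j * l / 2))\<bar> \<ge> 2" for j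
    using trace[OF mul[OF assms(3) diag_of_int_mult[OF assms(1)]], of j]
    by (simp add: diag_def)
  have P: "\<bar>p * s - 1\<bar> \<ge> E * \<bar>p * s\<bar>"
    using neg dt unfolding E_def by (simp add: algebra_simps)
  have vanish: "\<exists>n::nat. \<bar>c\<bar> * exp (- (real n * l / 2)) < 2" for c
  proof -
    obtain n where n: "ln (\<bar>c\<bar> + 1) < real n * (l / 2)"
      using reals_Archimedean3[of "l / 2"] assms(2) by auto
    have "\<bar>c\<bar> + 1 = exp (ln (\<bar>c\<bar> + 1))" by simp
    also have "\<dots> < exp (real n * (l / 2))" using n by (simp only: exp_less_cancel_iff)
    finally have "\<bar>c\<bar> < exp (real n * l / 2)" by simp
    hence "\<bar>c\<bar> * exp (- (real n * l / 2)) < 1"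
      by (simp add: exp_minus divide_simps)
    thus ?thesis by (intro exI[of _ n]) simp
  qed
  show False
  proof (cases "p * s = 0")
    case True
    \<comment> \<open>Only one summand of the trace is left, and a power of \<open>diag l\<close>
      with exponent of the right sign makes it smaller than \<open>2\<close>.\<close>
    then consider "s = 0" | "p = 0" by fastforce
    thus False
    proof cases
      case 1
      obtain n :: nat where "\<bar>p\<bar> * exp (- (real n * l / 2)) < 2" using vanish by blast
      thus False using tr[of "- int n"] 1 by (simp add: abs_mult)
    next
      case 2
      obtain n :: nat where "\<bar>s\<bar> * exp (- (real n * l / 2)) < 2" using vanish by blast
      thus False using tr[of "int n"] 2 by (simp add: abs_mult)
    qed
  next
    case False
    hence ps: "p \<noteq> 0" "s \<noteq> 0" by auto
    \<comment> \<open>At \<open>of_int j * l = \<rho>\<close> both summands of the trace would have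
      the same absolute value; rounding to an integer \<open>j\<close> leaves an error
      \<open>\<tau>\<close> of at most \<open>l / 2\<close>.\<close>
    define \<rho> where "\<rho> = ln (\<bar>s\<bar> / \<bar>p\<bar>)"
    have \<rho>: "exp \<rho> = \<bar>s\<bar> / \<bar>p\<bar>" using ps by (simp add: \<rho>_def)
    define j where "j = round (\<rho> / l)"
    define \<tau> where "\<tau> = of_int j * l - \<rho>"
    have "\<bar>of_int j - \<rho> / l\<bar> \<le> 1 / 2"
      unfolding j_def by (rule of_int_round_abs_le)
    hence "\<bar>of_int j - \<rho> / l\<bar> * l \<le> 1 / 2 * l"
      using assms(2) by (intro mult_right_mono) auto
    also have "\<bar>of_int j - \<rho> / l\<bar> * l = \<bar>(of_int j - \<rho> / l) * l\<bar>"
      using assms(2) by (simp add: abs_mult)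
    also have "(of_int j - \<rho> / l) * l = \<tau>"
      using assms(2) by (simp add: \<tau>_def field_simps)
    finally have "cosh \<bar>\<tau>\<bar> \<le> cosh (l / 2)"
      using assms(2) by (subst cosh_real_nonneg_le_iff) auto
    hence ch: "cosh \<tau> \<le> cosh (l / 2)" by simp
    define h where "h = exp (l / 2)"
    have h: "h > 1" "E = h * h" using assms(2) by (simp_all add: h_def E_def flip: exp_add)
    have ch2: "2 * cosh \<tau> \<le> h + 1 / h"
      using ch by (simp add: cosh_def h_def exp_minus inverse_eq_divide)
    define x where "x = of_int j * l / 2"
    have e1: "p\<^sup>2 * exp (2 * x) = \<bar>p * s\<bar> * exp \<tau>"
      using ps by (simp add: \<tau>_def exp_diff \<rho> x_def power2_eq_square abs_mult)
    have e2: "s\<^sup>2 * exp (- (2 * x)) = \<bar>p * s\<bar> * exp (- \<tau>)"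
      using ps by (simp add: \<tau>_def exp_diff exp_minus \<rho> x_def power2_eq_square abs_mult field_simps)
    have "4 \<le> \<bar>p * exp x + s * exp (- x)\<bar>\<^sup>2"
      using power_mono[OF tr[of j], of 2] by (simp add: x_def)
    also have "\<dots> = p\<^sup>2 * (exp x * exp x) + s\<^sup>2 * (exp (- x) * exp (- x)) + 2 * (p * s) * (exp x * exp (- x))"
      by (simp add: power2_eq_square algebra_simps)
    also have "\<dots> = p\<^sup>2 * exp (2 * x) + s\<^sup>2 * exp (- (2 * x)) + 2 * (p * s)"
      by (simp flip: exp_add)
    also have "\<dots> = \<bar>p * s\<bar> * (2 * cosh \<tau>) + 2 * (p * s)"
      unfolding e1 e2 by (simp add: cosh_def algebra_simps)
    also have "\<dots> \<le> \<bar>p * s\<bar> * (h + 1 / h) + 2 * (p * s)"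
      using ch2 by (intro add_right_mono mult_left_mono) auto
    finally have ge: "4 \<le> \<bar>p * s\<bar> * (h + 1 / h) + 2 * (p * s)" .
    have "1 / h < 1" using h by simp
    define P where "P = \<bar>p * s\<bar>"
    have Pp: "P > 0" using ps by (simp add: P_def)
    show False
    \<comment> \<open>The negated claim bounds \<open>P\<close> by \<open>1 / (E + 1)\<close> or
      \<open>1 / (E - 1)\<close> according to the sign of \<open>p * s\<close>; either bound
      contradicts \<open>ge\<close>, whose last term has that same sign.\<close>
    proof (cases "p * s > 0")
      case True
      have "P \<noteq> 0 \<longrightarrow> E * P > P" using h Pp E by simp
      hence "E * P + P \<le> 1"
        using P True Pp unfolding P_def by (auto simp: abs_if split: if_splits)
      moreover have "4 \<le> P * (h + 1 / h + 2)"
        using ge True by (simp add: P_def algebra_simps)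
      moreover have "P * (h + 1 / h + 2) < P * (4 * (E + 1))"
      proof -
        have "h \<le> E" using h by simp
        hence "i < 1 \<Longrightarrow> h + i + 2 < 4 * (E + 1)" for i using h(1) by argo
        hence "h + 1 / h + 2 < 4 * (E + 1)" using \<open>1 / h < 1\<close> by blast
        thus ?thesis using Pp by (intro mult_strict_left_mono)
      qed
      ultimately show False by (simp add: algebra_simps)
    next
      case F: False
      hence "p * s < 0" using ps False by linarith
      hence "E * P \<le> 1 + P"
        using P unfolding P_def by (auto simp: abs_if split: if_splits)
      moreover have "4 \<le> P * (h + 1 / h - 2)"
        using ge \<open>p * s < 0\<close> by (simp add: P_def algebra_simps)
      moreover have "P * (h + 1 / h - 2) < P * (4 * (E - 1))"
      proof -
        have "(h - 1) * (4 * h + 3) > 0" using h by (intro mult_pos_pos) auto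
        hence "h + 3 < 4 * E" using h by (simp add: algebra_simps)
        hence "i < 1 \<Longrightarrow> h + i - 2 < 4 * (E - 1)" for i by argo
        hence "h + 1 / h - 2 < 4 * (E - 1)" using \<open>1 / h < 1\<close> by blast
        thus ?thesis using Pp by (intro mult_strict_left_mono)
      qed
      ultimately show False by (simp add: algebra_simps)
    qed
  qed
qed

text \<open>With \<open>k = q * r\<close>, the commutator of \<open>A\<close> and \<open>diag l\<close> has trace \<open>2 - k * (exp (l/2) - exp (- l/2))\<^sup>2\<close>;
  if \<open>k\<close> is too small, then this is elliptic (\<open>k > 0\<close>), unipotent (\<open>k = 0\<close>), or too close to \<open>2\<close>
  for the descent (\<open>k < 0\<close>).\<close>
lemma off_diagonal_lower_bound:
  assumes "diag l \<in> G" "l > 0" "(p, q, r, s) \<in> G" "q \<noteq> 0 \<or> r \<noteq> 0"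
  shows "\<bar>p * s\<bar> < exp l * \<bar>q * r\<bar>"
proof (rule ccontr)
  assume neg: "\<not> ?thesis"
  have dt: "p * s - q * r = 1" using det[OF assms(3)] by simp
  define h where "h = exp (l / 2)"
  have h: "h > 1" "exp l = h * h" "exp (- (l / 2)) = 1 / h"
    using assms(2) by (simp_all add: h_def exp_minus inverse_eq_divide flip: exp_add)
  have dl: "diag l = (h, 0, 0, 1 / h)" by (simp add: diag_def h_def exp_minus inverse_eq_divide)
  define k where "k = q * r"
  have k: "h * h * \<bar>k\<bar> \<le> \<bar>1 + k\<bar>"
    using neg dt h by (simp add: k_def algebra_simps)
  have hh: "h * h > 1" using h by (simp add: less_1_mult)
  have sq: "(h - 1 / h)\<^sup>2 = (h * h - 1) * (1 - 1 / (h * h))"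
    using h(1) by (simp add: power2_eq_square field_simps)
  have inv: "0 < 1 / (h * h)" "1 / (h * h) < 1" using hh by auto
  define A where "A = (p, q, r, s)"
  have AG: "A \<in> G" using assms(3) by (simp add: A_def)
  define C where "C = A \<odot> diag l \<odot> madj A \<odot> madj (diag l)"
  have CG: "C \<in> G" unfolding C_def using AG assms(1) mul adj by blast
  have C: "C = (p * s - q * r / (h * h), p * q * (1 - h * h), r * s * (1 - 1 / (h * h)), p * s - q * r * (h * h))"
    using h(1) by (simp add: C_def A_def dl field_simps)
  have "mtrace C = 2 * (p * s) - q * r * (h * h + 1 / (h * h))"
    unfolding C by (simp add: algebra_simps)
  hence trC: "mtrace C = 2 - k * (h - 1 / h)\<^sup>2"
    using dt h by (simp add: k_def power2_eq_square algebra_simps)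
  consider "k = 0" | "k > 0" | "k < 0" by linarith
  thus False
  proof cases
    case 1
    hence qr: "q * r = 0" "p * s = 1" using dt by (auto simp: k_def)
    hence ps: "p \<noteq> 0" "s \<noteq> 0" by auto
    \<comment> \<open>A triangular \<open>A\<close> has a unipotent commutator with
      \<open>diag l\<close>.\<close>
    have "q = 0 \<or> r = 0" using qr by simp
    thus False
    proof
      assume "r = 0"
      hence "C = (1, p * q * (1 - h * h), 0, 1)" unfolding C using qr by simp
      hence "p * q * (1 - h * h) = 0" using no_unipotent[OF assms(1,2)] CG by metis
      thus False using ps hh assms(4) \<open>r = 0\<close> by simp
    next
      assume "q = 0"
      hence "C = (1, 0, r * s * (1 - 1 / (h * h)), 1)" unfolding C using qr by simp
      hence "r * s * (1 - 1 / (h * h)) = 0" using no_unipotent[OF assms(1,2)] CG by metis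
      thus False using ps hh assms(4) \<open>q = 0\<close> by simp
    qed
  next
    case 2
    \<comment> \<open>This puts the trace of \<open>C\<close> strictly between \<open>1\<close> and
      \<open>2\<close>.\<close>
    have "k * (h * h - 1) \<le> 1" using k 2 by (simp add: algebra_simps)
    hence "k * (h * h - 1) * (1 - 1 / (h * h)) \<le> 1 * (1 - 1 / (h * h))"
      using hh by (intro mult_right_mono) auto
    hence "k * (h - 1 / h)\<^sup>2 < 1"
      using inv unfolding sq mult.assoc by argo
    moreover have "k * (h - 1 / h)\<^sup>2 > 0"
      using 2 hh inv unfolding sq by (intro mult_pos_pos) auto
    ultimately show False using trace[OF CG] trC by linarith
  next
    case 3
    define c where "c = h * h * k"
    have "h * h * (- k) > 1 * (- k)" using hh 3 by (intro mult_strict_right_mono) auto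
    hence c: "c < k" by (simp add: c_def)
    have "- c \<le> \<bar>1 + k\<bar>" using k 3 by (simp add: c_def)
    hence ck: "- c - k \<le> 1" using c by linarith
    hence k1: "- k * (h * h + 1) \<le> 1" by (simp add: c_def algebra_simps)
    have ps: "p * s > 0" using dt c ck 3 unfolding k_def by linarith
    \<comment> \<open>The sign makes the diagonal entries positive; then the traces of
      \<open>B\<close>, \<open>diag l\<close> and their product are positive, hence at least
      \<open>2\<close>.\<close>
    define B where "B = (if p > 0 then A else - A)"
    define p' where "p' = \<bar>p\<bar>"
    define s' where "s' = \<bar>s\<bar>"
    have pp: "p' > 0" "s' > 0" "p' * s' = 1 + k"
      using ps dt by (auto simp: p'_def s'_def k_def simp flip: abs_mult)
    have BG: "B \<in> G" using AG neg[of] sl2_subgroup.neg[OF sl2_subgroup_axioms AG] by (simp add: B_def)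
    have trs: "mtrace B = p' + s'" "mtrace (B \<odot> diag l) = p' * h + s' / h"
      using ps by (auto simp: B_def A_def p'_def s'_def dl zero_less_mult_iff)
    have pos: "p' + s' > 0" "p' * h + s' / h > 0" "h + 1 / h > 0" using pp h by (auto intro: add_pos_pos)
    have ge: "p' + s' \<ge> 2" "p' * h + s' / h \<ge> 2" "h + 1 / h \<ge> 2"
      using trace[OF BG] trace[OF mul[OF BG assms(1)]] trace[OF assms(1)] pos trs by (auto simp: dl)
    have e: "(mtrace B)\<^sup>2 + (mtrace (diag l))\<^sup>2 + (mtrace (B \<odot> diag l))\<^sup>2 - mtrace B * mtrace (diag l) * mtrace (B \<odot> diag l) - 2
      = 2 - k * (h - 1 / h)\<^sup>2"
    proof -
      \<comment> \<open>Writing \<open>i\<close> for \<open>1 / h\<close> turns Fricke's expression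
        into a polynomial identity modulo \<open>h * i = 1\<close>.\<close>
      have "(p' + s')\<^sup>2 + (h + i)\<^sup>2 + (p' * h + s' * i)\<^sup>2 - (p' + s') * (h + i) * (p' * h + s' * i) - 2
        = 2 - (p' * s' - 1) * (h - i)\<^sup>2" if "h * i = 1" for i
        using that by algebra
      from this[of "1 / h"] show ?thesis
        unfolding trs using h(1) pp(3) by (simp add: dl)
    qed
    \<comment> \<open>The bounds that follow place the commutator trace strictly between
      \<open>2\<close> and \<open>3\<close>, inside the range of the descent.\<close>
    have "- k * (h * h - 1) \<le> 1" using k1 3 by (simp add: algebra_simps)
    hence "- k * (h * h - 1) * (1 - 1 / (h * h)) \<le> 1 * (1 - 1 / (h * h))"
      using hh by (intro mult_right_mono) auto
    hence "- k * (h - 1 / h)\<^sup>2 < 1"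
      using inv unfolding sq mult.assoc by argo
    moreover have "- k * (h - 1 / h)\<^sup>2 > 0"
      using 3 hh inv unfolding sq by (intro mult_pos_pos) auto
    ultimately show False
      using no_small_commutator[OF BG assms(1), unfolded e] ge trs by (simp add: dl)
  qed
qed

end

section \<open>The hyperbolic plane and its orientation-preserving isometries\<close>

fun mob :: "mat2 \<Rightarrow> complex \<Rightarrow> complex" where
  "mob (a, b, c, d) z = (of_real a * z + of_real b) / (of_real c * z + of_real d)"

text \<open>For determinant one the image stays in the upper half-plane; outside it,
  \<open>of_coord\<close> is unspecified.\<close>

definition act :: "mat2 \<Rightarrow> hyp_plane \<Rightarrow> hyp_plane" where
  "act A x = of_coord (mob A (coord x))"

lemma coord_of_coord [simp]: "Im z > 0 \<Longrightarrow> coord (of_coord z) = z"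
  using of_coord_inverse by simp

lemma of_coord_coord [simp]: "of_coord (coord x) = x"
  by (rule coord_inverse)

lemma mob_denom:
  assumes "a * d - b * c = 1" "Im z > 0"
  shows "of_real c * z + of_real d \<noteq> 0"
proof
  assume *: "of_real c * z + of_real d = 0"
  hence "c * Im z = 0" by (simp add: complex_eq_iff)
  hence "c = 0" using assms(2) by simp
  thus False using * assms(1) by simp
qed

lemma Im_mob:
  assumes "a * d - b * c = 1" "Im z > 0"
  shows "Im (mob (a, b, c, d) z) = Im z / (cmod (of_real c * z + of_real d))\<^sup>2"
proof -
  have "a * Im z * (c * Re z + d) - (a * Re z + b) * (c * Im z) = (a * d - b * c) * Im z"
    by algebra
  thus ?thesis
    using assms by (simp add: Im_divide cmod_power2)
qed

lemma Im_mob_pos: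
  assumes "mdet A = 1" "Im z > 0"
  shows "Im (mob A z) > 0"
proof -
  obtain a b c d where A: "A = (a, b, c, d)" by (cases A)
  show ?thesis using assms mob_denom[of a d b c z] unfolding A by (subst Im_mob) auto
qed

lemma coord_act [simp]: "mdet A = 1 \<Longrightarrow> coord (act A x) = mob A (coord x)"
  by (simp add: act_def Im_mob_pos Im_coord_pos)

lemma mob_mmul:
  assumes "mdet A = 1" "mdet B = 1" "Im z > 0"
  shows "mob (A \<odot> B) z = mob A (mob B z)"
proof -
  obtain a b c d where A: "A = (a, b, c, d)" by (cases A)
  obtain a' b' c' d' where B: "B = (a', b', c', d')" by (cases B)
  define n where "n = of_real a' * z + of_real b'"
  define m where "m = of_real c' * z + of_real d'"
  have m: "m \<noteq> 0" using mob_denom[of a' d' b' c' z] assms by (simp add: B m_def)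
  have "mob A (mob B z) = (of_real a * (n / m) + of_real b) / (of_real c * (n / m) + of_real d)"
    by (simp add: A B n_def m_def)
  also have "\<dots> = (of_real a * n + of_real b * m) / (of_real c * n + of_real d * m)"
  proof -
    have "of_real a * (n / m) + of_real b = (of_real a * n + of_real b * m) / m"
      "of_real c * (n / m) + of_real d = (of_real c * n + of_real d * m) / m"
      using m by (simp_all add: field_simps)
    thus ?thesis using m by simp
  qed
  also have "\<dots> = mob (A \<odot> B) z"
    by (simp add: A B n_def m_def algebra_simps)
  finally show ?thesis ..
qed

text \<open>The difference \<open>z - w\<close> is divided by \<open>m * n\<close> and the imaginary
  parts by the squared moduli of \<open>m\<close> and \<open>n\<close>, so the factors cancel in the
  quotient.\<close>

lemma cosh_dist_mob:
  assumes "mdet A = 1" "Im z > 0" "Im w > 0"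
  shows "cosh_dist (mob A z) (mob A w) = cosh_dist z w"
proof -
  obtain a b c d where A: "A = (a, b, c, d)" by (cases A)
  have dt: "a * d - b * c = 1" using assms by (simp add: A)
  define m where "m = of_real c * z + of_real d"
  define n where "n = of_real c * w + of_real d"
  have mn: "m \<noteq> 0" "n \<noteq> 0" using mob_denom[OF dt] assms by (auto simp: m_def n_def)
  have "(of_real a * z + of_real b) * n - (of_real a * w + of_real b) * m = of_real (a * d - b * c) * (z - w)"
    by (simp add: m_def n_def algebra_simps)
  hence "mob A z - mob A w = (z - w) / (m * n)"
    using mn dt by (simp add: A m_def[symmetric] n_def[symmetric] diff_frac_eq)
  hence "(cmod (mob A z - mob A w))\<^sup>2 = (cmod (z - w))\<^sup>2 / ((cmod m)\<^sup>2 * (cmod n)\<^sup>2)"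
    by (simp add: norm_divide norm_mult power_divide power_mult_distrib)
  moreover have "Im (mob A z) = Im z / (cmod m)\<^sup>2" "Im (mob A w) = Im w / (cmod n)\<^sup>2"
    unfolding A m_def n_def using Im_mob[OF dt] assms by auto
  ultimately show ?thesis
    using mn by (simp add: cosh_dist_def)
qed

lemma act_mmul: "mdet A = 1 \<Longrightarrow> mdet B = 1 \<Longrightarrow> act (A \<odot> B) x = act A (act B x)"
  by (simp add: act_def mob_mmul Im_coord_pos Im_mob_pos)

lemma act_mone [simp]: "act mone x = x"
  by (simp add: act_def mone_def)

lemma act_uminus [simp]: "act (- A) x = act A x"
proof -
  obtain a b c d where A: "A = (a, b, c, d)" by (cases A)
  have "(- u - v) / (- w - t) = (u + v) / (w + t)" for u v w t :: complex
    using minus_divide_divide[of "u + v" "w + t"] by simp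
  thus ?thesis by (simp add: A act_def)
qed

lemma act_madj [simp]:
  assumes "mdet A = 1"
  shows "act (madj A) (act A x) = x" "act A (act (madj A) x) = x"
  using act_mmul[of "madj A" A x] act_mmul[of A "madj A" x] assms by simp_all

lemma dist_act [simp]: "mdet A = 1 \<Longrightarrow> dist (act A x) (act A y) = dist x y"
  by (simp add: dist_hyp_plane_def cosh_dist_mob Im_coord_pos)

section \<open>Geodesic lines as images of the imaginary axis\<close>

lemma dist_eq_iff_cosh:
  fixes x y :: hyp_plane
  assumes "d \<ge> 0"
  shows "dist x y = d \<longleftrightarrow> cosh_dist (coord x) (coord y) = cosh d"
  using assms cosh_dist_ge_1[OF Im_coord_pos Im_coord_pos, of x y]
  by (auto simp: dist_hyp_plane_def arcosh_cosh_real)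

lemma cosh_dist_eq:
  fixes x y :: hyp_plane
  shows "cosh_dist (coord x) (coord y) = cosh (dist x y)"
  using dist_eq_iff_cosh[of "dist x y" x y] by simp

lemma cosh_dist_Re_Im:
  assumes "Im z > 0" "Im w > 0"
  shows "cosh_dist z w = ((Re z - Re w)\<^sup>2 + (Im z)\<^sup>2 + (Im w)\<^sup>2) / (2 * Im z * Im w)"
  unfolding cosh_dist_def cmod_power2 using assms by (simp add: field_simps power2_eq_square)

text \<open>The model geodesic line: on the imaginary axis the distance is the difference of
  logarithms, so \<open>exp\<close> gives arc length.\<close>

definition iaxis :: "real \<Rightarrow> hyp_plane" where
  "iaxis t = of_coord (Complex 0 (exp t))"

lemma coord_iaxis [simp]: "coord (iaxis t) = Complex 0 (exp t)"
  by (simp add: iaxis_def)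

lemma cosh_dist_iaxis:
  assumes "Im z > 0"
  shows "cosh_dist z (Complex 0 (exp t)) = ((Re z)\<^sup>2 + (Im z)\<^sup>2 + exp (2 * t)) / (2 * Im z * exp t)"
  using assms by (subst cosh_dist_Re_Im) (auto simp: power2_eq_square simp flip: exp_add)

lemma dist_iaxis [simp]: "dist (iaxis s) (iaxis t) = \<bar>s - t\<bar>"
proof -
  have "cosh_dist (coord (iaxis s)) (coord (iaxis t)) = (exp s * exp s + exp t * exp t) / (2 * exp s * exp t)"
    by (simp add: cosh_dist_iaxis power2_eq_square flip: exp_add)
  also have "\<dots> = cosh (s - t)"
    by (simp add: cosh_def exp_diff exp_minus field_simps)
  finally show ?thesis by (subst dist_eq_iff_cosh) auto
qed

text \<open>Cleared of denominators, each distance condition is linear in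
  \<open>exp (2 * s)\<close>; the difference of the two gives the imaginary part, and either one
  then gives real part \<open>0\<close>.\<close>

lemma iaxis_unique:
  assumes "dist z (iaxis a) = \<bar>t - a\<bar>" "dist z (iaxis b) = \<bar>t - b\<bar>" "a \<noteq> b"
  shows "z = iaxis t"
proof -
  define x y T where "x = Re (coord z)" "y = Im (coord z)" "T = exp t"
  note defs = this
  have y: "y > 0" "T > 0" by (simp_all add: defs Im_coord_pos)
  have *: "x\<^sup>2 + y\<^sup>2 + exp (2 * s) = y * (T + exp (2 * s) / T)" if "dist z (iaxis s) = \<bar>t - s\<bar>" for s
  proof -
    have "cosh_dist (coord z) (coord (iaxis s)) = cosh (t - s)"
      using that cosh_dist_eq[of z "iaxis s"] by simp
    hence "(x\<^sup>2 + y\<^sup>2 + exp (2 * s)) / (2 * y * exp s) = cosh (t - s)"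
      by (simp add: cosh_dist_iaxis Im_coord_pos defs)
    hence "x\<^sup>2 + y\<^sup>2 + exp (2 * s) = y * (2 * exp s * cosh (t - s))"
      using y by (simp add: field_simps)
    also have "2 * exp s * cosh (t - s) = T + exp (2 * s) / T"
      by (simp add: cosh_def defs algebra_simps flip: exp_add exp_diff)
    finally show ?thesis .
  qed
  have "y * (exp (2 * a) - exp (2 * b)) = T * (exp (2 * a) - exp (2 * b))"
    using *[OF assms(1)] *[OF assms(2)] y by (simp add: field_simps)
  hence yT: "y = T" using assms(3) by simp
  hence "x = 0" using *[OF assms(1)] y by (simp add: field_simps power2_eq_square)
  hence "coord z = coord (iaxis t)" using yT by (simp add: defs complex_eq_iff)
  thus ?thesis by (simp only: coord_inject)
qed

text \<open>Rotations about \<open>iaxis 0\<close> act transitively on the circles around it. The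
  matrix is found by solving for the sine and cosine from the coordinates of
  \<open>w\<close>.\<close>

lemma ex_rotation:
  "\<exists>A. mdet A = 1 \<and> act A (iaxis 0) = iaxis 0 \<and> act A (iaxis (dist (iaxis 0) w)) = w"
proof (cases "w = iaxis 0")
  case True
  thus ?thesis by (intro exI[of _ mone]) simp
next
  case False
  define x y E where "x = Re (coord w)" "y = Im (coord w)" "E = exp (dist (iaxis 0) w)"
  note defs = this
  have y: "y > 0" and E: "E > 1" using False by (auto simp: defs Im_coord_pos)
  have "cosh_dist (coord w) (coord (iaxis 0)) = cosh (dist (iaxis 0) w)"
    by (simp only: cosh_dist_eq dist_commute)
  hence "(x\<^sup>2 + y\<^sup>2 + 1) / (2 * y) = (E + 1 / E) / 2"
    using cosh_dist_iaxis[of "coord w" 0]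
    by (simp add: defs Im_coord_pos cosh_def exp_minus inverse_eq_divide)
  hence eq: "(x\<^sup>2 + y\<^sup>2 + 1) * E = y * (E\<^sup>2 + 1)"
    using y E by (simp add: field_simps power2_eq_square)
  \<comment> \<open>The circle of radius \<open>ln E\<close> around \<open>iaxis 0\<close> has
    imaginary parts between \<open>1 / E\<close> and \<open>E\<close>, which makes \<open>u\<close>
    below a number in the unit interval.\<close>
  have "(E - y) * (E * y - 1) = x\<^sup>2 * E"
    using eq by algebra
  hence nn: "(E - y) * (E * y - 1) \<ge> 0" using E by simp
  have "y \<le> E \<and> 1 \<le> E * y"
  proof (rule ccontr)
    assume "\<not> ?thesis"
    hence "E < y \<and> E * y \<le> 1 \<or> E * y < 1 \<and> E \<le> y"
      using nn by (auto simp: zero_le_mult_iff)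
    moreover have "E * E > 1" using E by (simp add: less_1_mult)
    moreover have "E \<le> y \<Longrightarrow> E * E \<le> E * y" using E by simp
    ultimately show False by linarith
  qed
  hence yE: "y \<le> E" "1 \<le> E * y" by auto
  have E2: "E\<^sup>2 > 1" using E by (simp add: power2_eq_square less_1_mult)
  \<comment> \<open>The square of the sine, read off from the required imaginary part
    \<open>E / (c\<^sup>2 + s\<^sup>2 * E\<^sup>2) = y\<close>.\<close>
  define u where "u = (E / y - 1) / (E\<^sup>2 - 1)"
  have u0: "u \<ge> 0" using yE y E2 by (simp add: u_def)
  have u1: "1 - u = (E\<^sup>2 - E / y) / (E\<^sup>2 - 1)" using E2 by (simp add: u_def field_simps)
  have "E / y \<le> E\<^sup>2" using yE y E by (simp add: field_simps power2_eq_square)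
  hence u1': "1 - u \<ge> 0" unfolding u1 using E2 by simp
  \<comment> \<open>The real part of the image has the sign of
    \<open>c * s * (1 - E\<^sup>2)\<close> with \<open>E > 1\<close>, so \<open>s\<close> must be
    opposite in sign to \<open>x\<close>.\<close>
  define s where "s = (if x > 0 then - sqrt u else sqrt u)"
  define c where "c = sqrt (1 - u)"
  have sc: "s\<^sup>2 = u" "c\<^sup>2 = 1 - u" "s\<^sup>2 + c\<^sup>2 = 1" using u0 u1' by (auto simp: s_def c_def)
  have den: "c\<^sup>2 + s\<^sup>2 * E\<^sup>2 = E / y"
  proof -
    have "1 - u + u * E\<^sup>2 = 1 + u * (E\<^sup>2 - 1)" by (simp add: algebra_simps)
    also have "u * (E\<^sup>2 - 1) = E / y - 1" using E2 by (simp add: u_def)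
    finally show ?thesis unfolding sc by simp
  qed
  have "(c * s * (1 - E\<^sup>2))\<^sup>2 = (E / y - 1) * (E\<^sup>2 - E / y)"
  proof -
    have "(c * s * (1 - E\<^sup>2))\<^sup>2 = (u * (E\<^sup>2 - 1)) * ((1 - u) * (E\<^sup>2 - 1))"
      by (simp add: power_mult_distrib sc) algebra
    also have "u * (E\<^sup>2 - 1) = E / y - 1" using E2 by (simp add: u_def)
    also have "(1 - u) * (E\<^sup>2 - 1) = E\<^sup>2 - E / y" unfolding u1 using E2 by simp
    finally show ?thesis .
  qed
  also have "\<dots> = (x * E / y)\<^sup>2"
  proof -
    have "(E - y) * (E\<^sup>2 * y - E) = x\<^sup>2 * E\<^sup>2"
      using eq by algebra
    thus ?thesis using y by (simp add: field_simps power2_eq_square)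
  qed
  finally have "\<bar>c * s * (1 - E\<^sup>2)\<bar> = \<bar>x * E / y\<bar>"
    by (simp only: power2_eq_iff abs_eq_iff)
  moreover have "c * s * (1 - E\<^sup>2) \<ge> 0 \<longleftrightarrow> (x > 0 \<or> c * s = 0)"
    using E2 u0 u1' by (auto simp: s_def c_def zero_le_mult_iff mult_le_0_iff)
  moreover have "x * E / y \<ge> 0 \<longleftrightarrow> x \<ge> 0"
    using y E by (simp add: zero_le_divide_iff zero_le_mult_iff)
  ultimately have num: "c * s * (1 - E\<^sup>2) = x * E / y"
    using y E by (auto simp: abs_if split: if_splits)
  define A where "A = (c, s, - s, c)"
  have dA: "mdet A = 1" using sc by (simp add: A_def power2_eq_square)
  have i: "of_real c + - (of_real s) * \<i> \<noteq> 0"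
    using sc(3) by (auto simp: complex_eq_iff)
  have "mob A (Complex 0 1) = Complex 0 1"
    using i sc(3) by (auto simp: A_def complex_eq_iff Re_divide Im_divide power2_eq_square algebra_simps)
  hence 1: "act A (iaxis 0) = iaxis 0"
    using dA by (metis coord_act coord_iaxis coord_inject exp_zero)
  have "Re (mob A (Complex 0 E)) = c * s * (1 - E\<^sup>2) / (c\<^sup>2 + s\<^sup>2 * E\<^sup>2)"
    by (simp add: A_def Re_divide power2_eq_square algebra_simps)
  hence "Re (mob A (Complex 0 E)) = x" unfolding den num using y E by simp
  moreover have "Im (mob A (Complex 0 E)) = (s\<^sup>2 + c\<^sup>2) * E / (c\<^sup>2 + s\<^sup>2 * E\<^sup>2)"
    by (simp add: A_def Im_divide power2_eq_square algebra_simps)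
  hence "Im (mob A (Complex 0 E)) = y" unfolding den sc(3) using y E by simp
  ultimately have "coord (act A (iaxis (dist (iaxis 0) w))) = coord w"
    using dA by (simp add: complex_eq_iff defs)
  hence "act A (iaxis (dist (iaxis 0) w)) = w" by (simp only: coord_inject)
  thus ?thesis using 1 dA by blast
qed

text \<open>The affine map \<open>N\<close> moves \<open>iaxis 0\<close> to \<open>x\<close>; a
  rotation about \<open>iaxis 0\<close> performed first adjusts the direction.\<close>

lemma ex_act_iaxis:
  "\<exists>A. mdet A = 1 \<and> act A (iaxis 0) = x \<and> act A (iaxis (dist x y)) = y"
proof -
  define X Y where "X = Re (coord x)" "Y = Im (coord x)"
  note defs = this
  have Y: "Y > 0" by (simp add: defs Im_coord_pos)
  define N :: mat2 where "N = (sqrt Y, X / sqrt Y, 0, 1 / sqrt Y)"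
  have N: "mdet N = 1" using Y by (simp add: N_def)
  have "mob N (Complex 0 1) = Complex X Y"
    using Y by (simp add: N_def complex_eq_iff Re_divide Im_divide field_simps)
  hence "coord (act N (iaxis 0)) = coord x"
    using N by (simp add: defs)
  hence Nx: "act N (iaxis 0) = x" by (simp only: coord_inject)
  define w where "w = act (madj N) y"
  obtain A where A: "mdet A = 1" "act A (iaxis 0) = iaxis 0" "act A (iaxis (dist (iaxis 0) w)) = w"
    using ex_rotation by blast
  have "dist (iaxis 0) w = dist (act N (iaxis 0)) (act N w)" using N by simp
  also have "\<dots> = dist x y" using N Nx by (simp add: w_def)
  finally have "act (N \<odot> A) (iaxis (dist x y)) = y"
    using A N by (simp add: act_mmul w_def)
  moreover have "act (N \<odot> A) (iaxis 0) = x" using A N Nx by (simp add: act_mmul)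
  ultimately show ?thesis using A N by (intro exI[of _ "N \<odot> A"]) simp
qed

lemma geodesic_param_act_iaxis:
  assumes "mdet A = 1"
  shows "geodesic_param (\<lambda>t. act A (iaxis t))"
  using assms by (simp add: geodesic_param_def)

text \<open>A matrix carries the imaginary axis to a line through the two common points, and on both
  geodesics the position at time \<open>t\<close> is determined by its distances to these
  points.\<close>

lemma geodesic_param_unique:
  assumes "geodesic_param \<alpha>" "geodesic_param \<beta>" "\<alpha> a = \<beta> a" "\<alpha> b = \<beta> b" "a \<noteq> b"
  shows "\<alpha> = \<beta>"
proof -
  have wlog: "\<alpha> = \<beta>" if ab: "a < b" and g: "geodesic_param \<alpha>" "geodesic_param \<beta>" "\<alpha> a = \<beta> a" "\<alpha> b = \<beta> b" 
    for a b :: real and \<alpha> \<beta>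
  proof
    fix t
    have "dist (\<beta> a) (\<beta> b) = b - a" using g(2) ab by (simp add: geodesic_param_def)
    then obtain A where A: "mdet A = 1" "act A (iaxis 0) = \<beta> a" "act A (iaxis (b - a)) = \<beta> b"
      using ex_act_iaxis[of "\<beta> a" "\<beta> b"] by metis
    have "act (madj A) (\<zeta> t) = iaxis (t - a)" 
      if z: "geodesic_param \<zeta>" "\<zeta> a = \<beta> a" "\<zeta> b = \<beta> b" for \<zeta>
    proof (rule iaxis_unique[of _ 0 _ "b - a"])
      have dst: "dist (act (madj A) (\<zeta> t)) (iaxis s) = dist (\<zeta> t) (act A (iaxis s))" for s
        using A(1) dist_act[of A "act (madj A) (\<zeta> t)" "iaxis s"] by simp
      show "dist (act (madj A) (\<zeta> t)) (iaxis 0) = \<bar>t - a - 0\<bar>"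
        unfolding dst A using z by (simp add: geodesic_param_def flip: z(2))
      show "dist (act (madj A) (\<zeta> t)) (iaxis (b - a)) = \<bar>t - a - (b - a)\<bar>"
        unfolding dst A using z by (simp add: geodesic_param_def flip: z(3))
    qed (use ab in simp)
    from this[of \<alpha>] this[of \<beta>] g have "act A (act (madj A) (\<alpha> t)) = act A (act (madj A) (\<beta> t))"
      by simp
    thus "\<alpha> t = \<beta> t" using A(1) by simp
  qed
  show ?thesis
    using wlog[of a b \<alpha> \<beta>] wlog[of b a \<alpha> \<beta>] assms by linarith
qed

lemma geodesic_paramE:
  assumes "geodesic_param \<alpha>"
  obtains A where "mdet A = 1" "\<And>t. \<alpha> t = act A (iaxis t)"
proof -
  have "dist (\<alpha> 0) (\<alpha> 1) = 1" using assms by (simp add: geodesic_param_def)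
  then obtain A where A: "mdet A = 1" "act A (iaxis 0) = \<alpha> 0" "act A (iaxis 1) = \<alpha> 1"
    using ex_act_iaxis[of "\<alpha> 0" "\<alpha> 1"] by metis
  have "\<alpha> = (\<lambda>t. act A (iaxis t))"
    using geodesic_param_unique[OF assms geodesic_param_act_iaxis[OF A(1)], of 0 1] A by simp
  thus thesis using A(1) by (intro that) auto
qed

lemma geodesic_param_affine:
  assumes "geodesic_param \<alpha>" "\<bar>k\<bar> = 1"
  shows "geodesic_param (\<lambda>t. \<alpha> (k * t + c))"
  unfolding geodesic_param_def
proof (intro allI)
  fix s t
  have "\<bar>k * s - k * t\<bar> = \<bar>s - t\<bar>"
    using assms(2) by (simp flip: right_diff_distrib add: abs_mult)
  thus "dist (\<alpha> (k * s + c)) (\<alpha> (k * t + c)) = \<bar>s - t\<bar>"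
    using assms(1) by (simp add: geodesic_param_def)
qed

text \<open>Through two common points the parametrisations differ by an affine change of time of
  slope \<open>1\<close> or \<open>-1\<close>.\<close>

lemma geodesic_range_eq:
  assumes "geodesic_param \<alpha>" "geodesic_param \<beta>"
    and "x \<noteq> y" "x \<in> range \<alpha>" "x \<in> range \<beta>" "y \<in> range \<alpha>" "y \<in> range \<beta>"
  shows "range \<alpha> = range \<beta>"
proof -
  obtain a b c d where *: "x = \<alpha> a" "y = \<alpha> b" "x = \<beta> c" "y = \<beta> d"
    using assms by blast
  have "\<bar>a - b\<bar> = dist x y" "\<bar>c - d\<bar> = dist x y"
    using assms(1,2) unfolding geodesic_param_def by (metis *(1,2), metis *(3,4))
  hence cd: "\<bar>a - b\<bar> = \<bar>c - d\<bar>" by simp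
  have "a \<noteq> b" "c \<noteq> d" using assms(3) * by auto
  define k where "k = (b - a) / (d - c)"
  have k: "\<bar>k\<bar> = 1" using cd \<open>c \<noteq> d\<close> by (simp add: k_def)
  have \<beta>: "\<beta> = (\<lambda>t. \<alpha> (k * t + (a - k * c)))"
  proof (rule geodesic_param_unique[OF assms(2) geodesic_param_affine[OF assms(1) k] _ _ \<open>c \<noteq> d\<close>])
    show "\<beta> c = \<alpha> (k * c + (a - k * c))" using * by simp
    have "k * (d - c) = b - a" using \<open>c \<noteq> d\<close> by (simp add: k_def)
    hence "k * d + (a - k * c) = b" by (simp add: algebra_simps)
    thus "\<beta> d = \<alpha> (k * d + (a - k * c))" using * by simp
  qed
  have "k \<noteq> 0" using k by auto
  hence "\<alpha> s = \<beta> ((s - (a - k * c)) / k)" for s by (simp add: \<beta>)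
  hence "range \<alpha> \<subseteq> range \<beta>" by auto
  moreover have "range \<beta> \<subseteq> range \<alpha>" unfolding \<beta> by auto
  ultimately show ?thesis by blast
qed

section \<open>Orientation-preserving isometries and their matrices\<close>

lemma dist_eq_iaxis_imp_reflection:
  assumes "dist z (iaxis 0) = dist w (iaxis 0)" "dist z (iaxis 1) = dist w (iaxis 1)"
  shows "coord z = coord w \<or> coord z = - cnj (coord w)"
proof -
  define x y x' y' where "x = Re (coord z)" "y = Im (coord z)" "x' = Re (coord w)" "y' = Im (coord w)"
  note defs = this
  have y: "y > 0" "y' > 0" by (simp_all add: defs Im_coord_pos)
  have *: "(x\<^sup>2 + y\<^sup>2 + exp (2 * s)) * y' = (x'\<^sup>2 + y'\<^sup>2 + exp (2 * s)) * y"
    if "dist z (iaxis s) = dist w (iaxis s)" for s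
  proof -
    have "cosh_dist (coord z) (coord (iaxis s)) = cosh_dist (coord w) (coord (iaxis s))"
      unfolding cosh_dist_eq that ..
    thus ?thesis
      using y by (simp add: cosh_dist_iaxis Im_coord_pos frac_eq_eq flip: defs)
  qed
  have "(exp 2 - 1) * (y - y') = 0"
    using *[OF assms(1)] *[OF assms(2)] by (simp add: algebra_simps)
  hence "y = y'" by simp
  moreover have "x = x' \<or> x = - x'"
    using *[OF assms(1)] y \<open>y = y'\<close> by (simp add: power2_eq_iff)
  ultimately show ?thesis by (auto simp: defs complex_eq_iff)
qed

text \<open>A Moebius map is holomorphic: its derivative is multiplication by some
  \<open>m \<noteq> 0\<close>, which multiplies the Jacobian determinant by the squared modulus of
  \<open>m\<close>.\<close>

lemma orientation_preserving_act_comp: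
  assumes "orientation_preserving f" "mdet A = 1"
  shows "orientation_preserving (\<lambda>x. act A (f x))"
  unfolding orientation_preserving_def
proof
  fix x
  obtain D where D: "((\<lambda>z. coord (f (of_coord z))) has_derivative D) (at (coord x))"
      "Im (cnj (D 1) * D \<i>) > 0"
    using assms(1) unfolding orientation_preserving_def by blast
  obtain a b c d where A: "A = (a, b, c, d)" by (cases A)
  have dt: "a * d - b * c = 1" using assms(2) by (simp add: A)
  define w where "w = coord (f x)"
  have w: "of_real c * w + of_real d \<noteq> 0"
    using mob_denom[OF dt] by (simp add: w_def Im_coord_pos)
  define m where "m = 1 / (of_real c * w + of_real d)\<^sup>2"
  have "of_real a * (of_real c * w + of_real d) - (of_real a * w + of_real b) * of_real c = of_real (a * d - b * c)"
    by (simp add: algebra_simps)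
  hence m_eq: "(of_real a * (of_real c * w + of_real d) - (of_real a * w + of_real b) * of_real c) 
      / ((of_real c * w + of_real d) * (of_real c * w + of_real d)) = m"
    unfolding dt by (simp add: m_def power2_eq_square)
  have "((mob A) has_field_derivative m) (at w)"
    unfolding A mob.simps using w
    by (auto intro!: derivative_eq_intros simp: m_eq)
  hence "(mob A has_derivative (*) m) (at (coord (f (of_coord (coord x)))))"
    by (simp add: has_field_derivative_def w_def)
  from has_derivative_compose[OF D(1) this]
  have 1: "((\<lambda>z. coord (act A (f (of_coord z)))) has_derivative (\<lambda>h. m * D h)) (at (coord x))"
    using assms(2) by simp
  have "cnj (m * D 1) * (m * D \<i>) = of_real ((cmod m)\<^sup>2) * (cnj (D 1) * D \<i>)"
    unfolding complex_norm_square by (simp only: complex_cnj_mult mult_ac)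
  hence "Im (cnj (m * D 1) * (m * D \<i>)) = (cmod m)\<^sup>2 * Im (cnj (D 1) * D \<i>)"
    by (simp only: times_complex.simps complex_of_real_def complex.sel)
  moreover have "m \<noteq> 0" using w by (simp add: m_def)
  ultimately have "Im (cnj (m * D 1) * (m * D \<i>)) > 0" using D(2) by simp
  with 1 show "\<exists>D. ((\<lambda>z. coord (act A (f (of_coord z)))) has_derivative D) (at (coord x)) \<and>
          Im (cnj (D 1) * D \<i>) > 0" by blast
qed

text \<open>Each point is either fixed or reflected in the imaginary axis. The orientation at
  \<open>\<i>\<close> yields one fixed point off the axis, and the distance to that point excludes
  reflection everywhere else.\<close>

lemma isometry_fixing_iaxis:
  assumes iso: "\<And>x y. dist (f x) (f y) = dist x y" and "orientation_preserving f"
    and fix01: "f (iaxis 0) = iaxis 0" "f (iaxis 1) = iaxis 1"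
  shows "f z = z"
proof -
  define H where "H z = coord (f (of_coord z))" for z
  have H: "H z = z \<or> H z = - cnj z" if "Im z > 0" for z
    using dist_eq_iaxis_imp_reflection[of "f (of_coord z)" "of_coord z"] iso fix01 that
    by (metis H_def coord_of_coord)
  obtain D where D: "(H has_derivative D) (at \<i>)" "Im (cnj (D 1) * D \<i>) > 0"
    using assms(2) unfolding orientation_preserving_def H_def
    by (metis coord_of_coord one_complex.simps(2) imaginary_unit.simps(2) zero_less_one)
  have dir: "((\<lambda>s. H (\<i> + of_real s * v)) has_vector_derivative D v) (at 0)" for v
  proof -
    have "((\<lambda>s. \<i> + of_real s * v) has_derivative (\<lambda>s. of_real s * v)) (at 0)"
      by (auto intro!: derivative_eq_intros)
    moreover have "(H has_derivative D) (at (\<i> + of_real 0 * v))" using D(1) by simp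
    ultimately have "((\<lambda>s. H (\<i> + of_real s * v)) has_derivative (\<lambda>s. D (of_real s * v))) (at 0)"
      by (rule has_derivative_compose)
    moreover have "D (of_real s * v) = s *\<^sub>R D v" for s
      using linear_scale[OF has_derivative_linear[OF D(1)], of s v] by (simp add: scaleR_conv_of_real)
    ultimately show ?thesis by (simp add: has_vector_derivative_def)
  qed
  have "D \<i> = \<i>"
  proof -
    have "eventually (\<lambda>s::real. s > -1) (nhds 0)"
      by (intro eventually_nhds_in_open[of "{-1<..}", simplified]) auto
    hence "eventually (\<lambda>s. H (\<i> + of_real s * \<i>) = \<i> + of_real s * \<i>) (nhds 0)"
    proof eventually_elim
      case (elim s)
      thus ?case using H[of "\<i> + of_real s * \<i>"] by (auto simp: complex_eq_iff)
    qed
    moreover have "((\<lambda>s. \<i> + of_real s * \<i>) has_vector_derivative \<i>) (at 0)"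
      by (auto intro!: derivative_eq_intros simp: has_vector_derivative_def scaleR_conv_of_real)
    ultimately have "((\<lambda>s. H (\<i> + of_real s * \<i>)) has_vector_derivative \<i>) (at 0)"
      by (subst has_vector_derivative_cong_ev[where g = "\<lambda>s. \<i> + of_real s * \<i>"]) (auto dest: eventually_nhds_x_imp_x)
    thus ?thesis using dir[of \<i>] vector_derivative_unique_at by blast
  qed
  \<comment> \<open>If all these points were reflected, then \<open>D 1 = -1\<close>, which with
    \<open>D \<i> = \<i>\<close> makes the determinant negative.\<close>
  have "\<exists>s. s \<noteq> 0 \<and> H (\<i> + of_real s) = \<i> + of_real s"
  proof (rule ccontr)
    assume neg: "\<not> ?thesis"
    have "H (\<i> + of_real s) = \<i> - of_real s" for s
      using neg H[of "\<i> + of_real s"] by (cases "s = 0") (auto simp: complex_eq_iff)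
    hence "((\<lambda>s. \<i> - of_real s) has_vector_derivative D 1) (at 0)"
      using dir[of 1] by simp
    moreover have "((\<lambda>s. \<i> - of_real s :: complex) has_vector_derivative -1) (at 0)"
      by (auto intro!: derivative_eq_intros simp: has_vector_derivative_def scaleR_conv_of_real)
    ultimately have "D 1 = -1" by (rule vector_derivative_unique_at)
    thus False using D(2) \<open>D \<i> = \<i>\<close> by simp
  qed
  then obtain s where s: "s \<noteq> 0" "H (\<i> + of_real s) = \<i> + of_real s" by blast
  define u where "u = of_coord (\<i> + of_real s)"
  have cu: "coord u = \<i> + of_real s" by (simp add: u_def)
  have fu: "f u = u" using s by (metis H_def u_def of_coord_coord)
  have "coord (f z) = coord z"
  proof (rule ccontr)
    assume ne: "coord (f z) \<noteq> coord z"
    hence r: "coord (f z) = - cnj (coord z)"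
      using H[of "coord z"] by (simp add: H_def Im_coord_pos)
    have "cosh_dist (coord (f z)) (coord u) = cosh_dist (coord z) (coord u)"
      unfolding cosh_dist_eq using iso[of z u] fu by simp
    hence "(- Re (coord z) - s)\<^sup>2 = (Re (coord z) - s)\<^sup>2"
      unfolding r using Im_coord_pos[of z] by (simp add: cosh_dist_Re_Im cu)
    hence "Re (coord z) * s = 0" by (simp add: power2_eq_square algebra_simps)
    hence "Re (coord z) = 0" using s by simp
    thus False using ne r by (simp add: complex_eq_iff)
  qed
  thus ?thesis by (simp only: coord_inject)
qed

lemma orientation_preserving_isometry_eq_act:
  assumes "hyp_isometry f" "orientation_preserving f"
  shows "\<exists>A. mdet A = 1 \<and> f = act A"
proof -
  have iso: "dist (f x) (f y) = dist x y" for x y using assms(1) by (simp add: hyp_isometry_def)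
  hence "dist (f (iaxis 0)) (f (iaxis 1)) = 1" by simp
  then obtain A where A: "mdet A = 1" "act A (iaxis 0) = f (iaxis 0)" "act A (iaxis 1) = f (iaxis 1)"
    using ex_act_iaxis[of "f (iaxis 0)" "f (iaxis 1)"] by metis
  have "act (madj A) (f z) = z" for z
  proof (rule isometry_fixing_iaxis[of "\<lambda>x. act (madj A) (f x)"])
    show "orientation_preserving (\<lambda>x. act (madj A) (f x))"
      using orientation_preserving_act_comp[OF assms(2)] A(1) by simp
  qed (use A iso in \<open>simp_all flip: A(2,3)\<close>)
  hence "f z = act A z" for z using A(1) by (metis act_madj(2))
  thus ?thesis using A(1) by blast
qed

text \<open>The equation for a fixed point at height \<open>exp t\<close> forces
  \<open>b = - c * (exp t)\<^sup>2\<close>; two different heights leave only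
  \<open>c = 0\<close>.\<close>

lemma act_fixes_iaxis_imp:
  assumes "mdet A = 1" "act A (iaxis 0) = iaxis 0" "act A (iaxis 1) = iaxis 1"
  shows "A = mone \<or> A = - mone"
proof -
  obtain a b c d where A: "A = (a, b, c, d)" by (cases A)
  have dt: "a * d - b * c = 1" using assms(1) by (simp add: A)
  have *: "a = d \<and> b = - c * (exp t)\<^sup>2" if "act A (iaxis t) = iaxis t" for t
  proof -
    define z where "z = Complex 0 (exp t)"
    have "mob A z = z" using that assms(1) by (metis coord_act coord_iaxis z_def)
    hence "of_real a * z + of_real b = z * (of_real c * z + of_real d)"
      using mob_denom[OF dt, of z] by (simp add: A z_def divide_eq_eq)
    thus ?thesis by (simp add: z_def complex_eq_iff power2_eq_square algebra_simps)
  qed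
  have "c * ((exp 1)\<^sup>2 - 1) = 0" using *[OF assms(2)] *[OF assms(3)] by (simp add: algebra_simps)
  moreover have "(exp 1 :: real)\<^sup>2 > 1" by (simp flip: exp_double)
  ultimately have "c = 0" by simp
  hence "b = 0" "a = d" using *[OF assms(2)] by auto
  hence "a * a = 1" using dt \<open>c = 0\<close> by simp
  hence "a = 1 \<or> a = -1" by (simp add: square_eq_1_iff)
  thus ?thesis using \<open>b = 0\<close> \<open>c = 0\<close> \<open>a = d\<close> by (auto simp: A mone_def)
qed

lemma act_inj:
  assumes "mdet A = 1" "mdet B = 1" "act A = act B"
  shows "A = B \<or> A = - B"
proof -
  have "act (madj B \<odot> A) x = x" for x using assms by (simp add: act_mmul)
  hence "madj B \<odot> A = mone \<or> madj B \<odot> A = - mone"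
    using assms(1,2) by (intro act_fixes_iaxis_imp) simp_all
  moreover have "B \<odot> (madj B \<odot> A) = A" using assms(2) by (simp flip: mmul_assoc)
  moreover have "B \<odot> (- mone) = - B" by (cases B) (simp add: mone_def)
  ultimately show ?thesis by (metis mone_mmul(2))
qed

lemma elliptic_fixes:
  assumes "mdet A = 1" "\<bar>mtrace A\<bar> < 2"
  shows "\<exists>x. act A x = x"
proof -
  obtain a b c d where A: "A = (a, b, c, d)" by (cases A)
  have dt: "a * d - b * c = 1" using assms(1) by (simp add: A)
  have "(a + d)\<^sup>2 < 4" using assms(2) abs_square_less_1[of "(a + d) / 2"] by (simp add: A power_divide)
  define q where "q = sqrt (4 - (a + d)\<^sup>2)"
  have q: "q > 0" "q\<^sup>2 = 4 - (a + d)\<^sup>2" using \<open>(a + d)\<^sup>2 < 4\<close> by (auto simp: q_def)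
  have c: "c \<noteq> 0"
  proof
    assume "c = 0"
    hence "(a + d)\<^sup>2 = (a - d)\<^sup>2 + 4" using dt by (simp add: power2_eq_square algebra_simps)
    thus False using \<open>(a + d)\<^sup>2 < 4\<close> using zero_le_power2[of "a - d"] by linarith
  qed
  \<comment> \<open>The root of \<open>c * z\<^sup>2 + (d - a) * z - b = 0\<close> in the upper
    half-plane; the discriminant \<open>(a + d)\<^sup>2 - 4\<close> is negative, and
    \<open>\<bar>c\<bar>\<close> selects the root.\<close>
  define z where "z = Complex ((a - d) / (2 * c)) (q / (2 * \<bar>c\<bar>))"
  have z: "Im z > 0" using q c by (simp add: z_def)
  have cc: "\<bar>c\<bar> * \<bar>c\<bar> = c * c" by simp
  have "Re (z * (of_real c * z + of_real d)) = c * ((Re z)\<^sup>2 - (Im z)\<^sup>2) + d * Re z"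
    by (simp add: power2_eq_square algebra_simps)
  also have "(Re z)\<^sup>2 - (Im z)\<^sup>2 = ((a - d)\<^sup>2 - q\<^sup>2) / (4 * (c * c))"
  proof -
    have "(Re z)\<^sup>2 = (a - d)\<^sup>2 / (4 * (c * c))" "(Im z)\<^sup>2 = q\<^sup>2 / (4 * (c * c))"
      by (simp_all add: z_def power_divide power_mult_distrib power2_eq_square[of c])
    thus ?thesis by (simp only: diff_divide_distrib)
  qed
  also have "c * (((a - d)\<^sup>2 - q\<^sup>2) / (4 * (c * c))) + d * Re z = ((a - d)\<^sup>2 - q\<^sup>2 + 2 * d * (a - d)) / (4 * c)"
    using c by (simp add: z_def field_simps)
  also have "(a - d)\<^sup>2 - q\<^sup>2 + 2 * d * (a - d) = 2 * a * (a - d) + 4 * (b * c)"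
    unfolding q(2) using dt by algebra
  also have "\<dots> / (4 * c) = a * Re z + b"
    using c by (simp add: z_def field_simps)
  finally have 1: "Re (z * (of_real c * z + of_real d)) = a * Re z + b" .
  have "Im (z * (of_real c * z + of_real d)) = Im z * (2 * c * Re z + d)"
    by (simp add: algebra_simps)
  also have "2 * c * Re z + d = a" using c by (simp add: z_def)
  finally have "of_real a * z + of_real b = z * (of_real c * z + of_real d)"
    using 1 by (simp add: complex_eq_iff)
  hence "mob A z = z" using mob_denom[OF dt z] by (simp add: A divide_eq_eq)
  hence "coord (act A (of_coord z)) = coord (of_coord z)" using assms(1) z by simp
  thus ?thesis unfolding coord_inject by blast
qed

section \<open>Surface groups\<close>

text \<open>The distance is a continuous expression in the coordinates that vanishes at equal
  points.\<close>

lemma continuous_on_hyp_planeI: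
  fixes f :: "'a::topological_space \<Rightarrow> hyp_plane"
  assumes "continuous_on S (\<lambda>x. coord (f x))"
  shows "continuous_on S f"
  unfolding continuous_on_def
proof
  fix x assume x: "x \<in> S"
  have "continuous_on S (\<lambda>y. cosh_dist (coord (f y)) (coord (f x)))"
  proof -
    have "Im (coord z) \<noteq> 0" for z using Im_coord_pos[of z] by simp
    thus ?thesis unfolding cosh_dist_def by (intro continuous_intros assms) auto
  qed
  hence "continuous_on S (\<lambda>y. arcosh (cosh_dist (coord (f y)) (coord (f x))))"
    by (rule continuous_on_compose2[OF continuous_on_arcosh[OF order.refl]])
      (auto intro: cosh_dist_ge_1 Im_coord_pos)
  hence "((\<lambda>y. dist (f y) (f x)) \<longlongrightarrow> dist (f x) (f x)) (at x within S)"
    using x unfolding continuous_on_def dist_hyp_plane_def by blast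
  thus "(f \<longlongrightarrow> f x) (at x within S)" by (subst tendsto_dist_iff) simp
qed

lemma mmul_fst_snd:
  "A \<odot> B = (fst A * fst B + fst (snd A) * fst (snd (snd B)),
     fst A * fst (snd B) + fst (snd A) * snd (snd (snd B)),
     fst (snd (snd A)) * fst B + snd (snd (snd A)) * fst (snd (snd B)),
     fst (snd (snd A)) * fst (snd B) + snd (snd (snd A)) * snd (snd (snd B)))"
  by (cases A; cases B) simp

lemma continuous_on_mmul [continuous_intros]:
  assumes "continuous_on S f" "continuous_on S g"
  shows "continuous_on S (\<lambda>x. f x \<odot> g x)"
  unfolding mmul_fst_snd using assms by (intro continuous_intros)

text \<open>Isometries carry the topology of pointwise convergence, so continuity is checked at each
  point of the plane. This transfers discreteness of \<open>\<Gamma>\<close> to matrices.\<close>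

lemma continuous_on_act: "continuous_on {A. mdet A = 1} act"
proof (rule continuous_on_coordinatewise_then_product, rule continuous_on_hyp_planeI)
  fix x
  have "continuous_on {A. mdet A = 1} (\<lambda>A. (of_real (fst A) * coord x + of_real (fst (snd A))) /
     (of_real (fst (snd (snd A))) * coord x + of_real (snd (snd (snd A)))))"
  proof (intro continuous_intros ballI)
    fix A assume "A \<in> {A. mdet A = 1}"
    thus "of_real (fst (snd (snd A))) * coord x + of_real (snd (snd (snd A))) \<noteq> 0"
      using mob_denom[OF _ Im_coord_pos] by (cases A) auto
  qed
  moreover have "coord (act A x) = (of_real (fst A) * coord x + of_real (fst (snd A))) /
     (of_real (fst (snd (snd A))) * coord x + of_real (snd (snd (snd A))))" if "mdet A = 1" for A
    using that by (cases A) simp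
  ultimately show "continuous_on {A. mdet A = 1} (\<lambda>A. coord (act A x))"
    by (subst continuous_on_cong[OF refl]) auto
qed

text \<open>Each point selects a basic open set that isolates it, and this selection is injective
  into a countable basis.\<close>

lemma countable_if_isolated:
  fixes S :: "'a::second_countable_topology set"
  assumes "discrete S"
  shows "countable S"
proof -
  obtain B :: "'a set set" where B: "countable B" "topological_basis B"
    using ex_countable_basis by blast
  have "\<exists>b\<in>B. b \<inter> S = {x}" if x: "x \<in> S" for x
  proof -
    obtain T where T: "open T" "T \<inter> S = {x}"
      using isolated_inE[OF discreteD[OF assms x]] .
    have "x \<in> T" using T(2) by auto
    obtain b where "b \<in> B" "x \<in> b" "b \<subseteq> T"
      using topological_basisE[OF B(2) T(1) \<open>x \<in> T\<close>] .
    thus ?thesis using T(2) that by (intro bexI[of _ b]) auto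
  qed
  hence "\<forall>x\<in>S. \<exists>b. b \<in> B \<and> b \<inter> S = {x}" by blast
  from bchoice[OF this] obtain b where b: "\<And>x. x \<in> S \<Longrightarrow> b x \<in> B \<and> b x \<inter> S = {x}" by blast
  have "inj_on b S"
  proof
    fix x y assume x: "x \<in> S" and y: "y \<in> S" and eq: "b x = b y"
    have "{x} = {y}"
      using conjunct2[OF b[OF x]] conjunct2[OF b[OF y]] unfolding eq by (rule trans[OF sym])
    thus "x = y" by simp
  qed
  moreover have "b ` S \<subseteq> B" using b by blast
  hence "countable (b ` S)" using B(1) by (rule countable_subset)
  ultimately show ?thesis using countable_image_inj_on by blast
qed

lemma act_diag_iaxis [simp]: "act (diag t) (iaxis s) = iaxis (s + t)"
proof -
  have "mob (diag t) (Complex 0 (exp s)) = Complex 0 (exp (s + t))"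
    by (simp add: diag_def complex_eq_iff Re_divide Im_divide power2_eq_square field_simps flip: exp_add)
  hence "coord (act (diag t) (iaxis s)) = coord (iaxis (s + t))" by simp
  thus ?thesis by (simp only: coord_inject)
qed

text \<open>The stabiliser of \<open>iaxis 0\<close>; as an isometry, \<open>rot t\<close> turns by
  the angle \<open>2 * t\<close>.\<close>

definition rot :: "real \<Rightarrow> mat2" where
  "rot t = (cos t, sin t, - sin t, cos t)"

lemma mdet_rot [simp]: "mdet (rot t) = 1"
  by (simp add: rot_def flip: power2_eq_square)

lemma rot_mmul: "rot s \<odot> rot t = rot (s + t)"
  by (simp add: rot_def cos_add sin_add algebra_simps)

lemma fixes_base_point_imp_rot:
  assumes "mdet A = 1" "act A (iaxis 0) = iaxis 0"
  shows "\<exists>t. A = rot t"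
proof -
  obtain a b c d where A: "A = (a, b, c, d)" by (cases A)
  have dt: "a * d - b * c = 1" using assms(1) by (simp add: A)
  have "mob A \<i> = \<i>" using assms by (metis coord_act coord_iaxis exp_zero Complex_eq_i)
  hence "of_real a * \<i> + of_real b = \<i> * (of_real c * \<i> + of_real d)"
    using mob_denom[OF dt, of \<i>] by (simp add: A divide_eq_eq)
  hence ad: "a = d" "c = - b" by (simp_all add: complex_eq_iff)
  have "d\<^sup>2 + b\<^sup>2 = 1" using dt by (simp add: ad power2_eq_square)
  then obtain t where "d = cos t" "b = sin t"
    using sincos_total_2pi by metis
  hence "A = rot t" by (simp add: A ad rot_def)
  thus ?thesis ..
qed

section \<open>Surface groups lifted to SL(2, R)\<close>

locale oriented_surface =
  fixes \<Gamma> :: "(hyp_plane \<Rightarrow> hyp_plane) set"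
  assumes surface: "surface_group \<Gamma>" and orientable: "orientable_quotient \<Gamma>"
begin

lemma isometry: "g \<in> \<Gamma> \<Longrightarrow> hyp_isometry g"
  and id_mem: "id \<in> \<Gamma>"
  and comp_mem: "g \<in> \<Gamma> \<Longrightarrow> h \<in> \<Gamma> \<Longrightarrow> g \<circ> h \<in> \<Gamma>"
  and inv_mem: "g \<in> \<Gamma> \<Longrightarrow> inv g \<in> \<Gamma>"
  and discrete: "discrete \<Gamma>"
  and torsion_free: "g \<in> \<Gamma> \<Longrightarrow> n > 0 \<Longrightarrow> g ^^ n = id \<Longrightarrow> g = id"
  using surface unfolding surface_group_def by blast+

lemma geodesic_param_comp:
  "g \<in> \<Gamma> \<Longrightarrow> geodesic_param \<alpha> \<Longrightarrow> geodesic_param (\<lambda>t. g (\<alpha> t))"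
  using isometry by (simp add: geodesic_param_def hyp_isometry_def)

lemma ex_matrix: "g \<in> \<Gamma> \<Longrightarrow> \<exists>A. mdet A = 1 \<and> g = act A"
  using orientation_preserving_isometry_eq_act isometry orientable
  unfolding orientable_quotient_def by blast

text \<open>The full preimage of \<open>\<Gamma>\<close> in SL(2, R), with both signs of every
  matrix.\<close>

definition mats :: "mat2 set" where
  "mats = {A. mdet A = 1 \<and> act A \<in> \<Gamma>}"

lemma image_mats: "\<Gamma> = act ` mats"
  using ex_matrix unfolding mats_def by blast

lemma mats_mmul:
  assumes "A \<in> mats" "B \<in> mats"
  shows "A \<odot> B \<in> mats"
proof -
  have "act (A \<odot> B) = act A \<circ> act B" using assms by (auto simp: mats_def act_mmul)
  thus ?thesis using assms comp_mem by (simp add: mats_def)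
qed

lemma mats_madj: "A \<in> mats \<Longrightarrow> madj A \<in> mats"
proof -
  assume A: "A \<in> mats"
  hence "act (madj A) = inv (act A)"
    by (intro ext inv_f_eq[symmetric] injI) (auto simp: mats_def dest: arg_cong[of _ _ "act (madj A)"])
  thus ?thesis using A inv_mem by (simp add: mats_def)
qed

lemma mats_uminus: "A \<in> mats \<Longrightarrow> - A \<in> mats"
proof -
  have "act (- A) = act A" by (intro ext) simp
  thus "A \<in> mats \<Longrightarrow> - A \<in> mats" by (simp add: mats_def)
qed

text \<open>By continuity of \<open>act\<close>, matrices of the group close to \<open>A\<close>
  induce the same isometry, so they are \<open>A\<close> or \<open>- A\<close>; the distance between
  these two excludes the latter.\<close>

lemma mats_isolated:
  assumes "A \<in> mats"
  shows "\<exists>e>0. \<forall>B\<in>mats. dist B A < e \<longrightarrow> B = A"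
proof -
  have A: "mdet A = 1" "act A \<in> \<Gamma>" using assms by (auto simp: mats_def)
  obtain T where T: "open T" "T \<inter> \<Gamma> = {act A}"
    using isolated_inE[OF discreteD[OF discrete A(2)]] .
  have "(act \<longlongrightarrow> act A) (at A within {A. mdet A = 1})"
    using continuous_on_act A unfolding continuous_on_def by blast
  hence "eventually (\<lambda>B. act B \<in> T) (at A within {A. mdet A = 1})"
    using T by (intro topological_tendstoD) auto
  then obtain d where d: "d > 0" "\<And>B. mdet B = 1 \<Longrightarrow> B \<noteq> A \<Longrightarrow> dist B A < d \<Longrightarrow> act B \<in> T"
    unfolding eventually_at by auto
  have "- A \<noteq> A" using A(1) by (cases A) auto
  hence "dist (- A) A > 0" by simp
  have "B = A" if "B \<in> mats" "dist B A < min d (dist (- A) A)" for B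
  proof (rule ccontr)
    assume "B \<noteq> A"
    hence "act B \<in> T" using d(2) that by (simp add: mats_def)
    hence "act B = act A" using T that by (auto simp: mats_def)
    hence "B = - A" using act_inj[of B A] A that \<open>B \<noteq> A\<close> by (auto simp: mats_def)
    thus False using that by simp
  qed
  thus ?thesis using d(1) \<open>dist (- A) A > 0\<close> by (intro exI[of _ "min d (dist (- A) A)"]) auto
qed

text \<open>Countability holds for the matrices, which live in a second countable space, and passes
  to their image \<open>\<Gamma>\<close>.\<close>

lemma countable_group: "countable \<Gamma>"
proof -
  have "discrete mats"
    unfolding discrete_def isolated_in_dist_Ex_iff using mats_isolated by (metis dist_commute)
  thus ?thesis using countable_if_isolated image_mats by (metis countable_image)
qed

text \<open>An element with a fixed point is conjugate to a rotation, and some positive power of it is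
  arbitrarily close to the identity.\<close>
lemma fixed_point_free:
  assumes g: "g \<in> \<Gamma>" and fix_x: "g x = x"
  shows "g = id"
proof -
  obtain A where A: "mdet A = 1" "g = act A" using ex_matrix[OF g] by blast
  obtain N where N: "mdet N = 1" "act N (iaxis 0) = x" using ex_act_iaxis by blast
  have "act (madj N \<odot> A \<odot> N) (iaxis 0) = act (madj N) (g x)"
    using A N by (simp add: act_mmul)
  also have "\<dots> = iaxis 0" using N act_madj(1)[of N "iaxis 0"] by (simp add: fix_x)
  finally obtain \<theta> where \<theta>: "madj N \<odot> A \<odot> N = rot \<theta>"
    using fixes_base_point_imp_rot[of "madj N \<odot> A \<odot> N"] A N by auto
  have "N \<odot> (madj N \<odot> A \<odot> N) \<odot> madj N = (N \<odot> madj N) \<odot> A \<odot> (N \<odot> madj N)"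
    by (simp only: mmul_assoc)
  hence AN: "A = N \<odot> rot \<theta> \<odot> madj N" using N by (simp add: \<theta>)
  define C where "C t = N \<odot> rot t \<odot> madj N" for t
  have C_add: "C s \<odot> C t = C (s + t)" for s t
  proof -
    have "C s \<odot> C t = N \<odot> rot s \<odot> ((madj N \<odot> N) \<odot> (rot t \<odot> madj N))"
      by (simp only: C_def mmul_assoc)
    thus ?thesis using N by (simp add: C_def rot_mmul flip: mmul_assoc) (simp add: rot_mmul mmul_assoc)
  qed
  have C0: "C 0 = mone" using N by (simp add: C_def rot_def flip: mone_def)
  have detC: "mdet (C t) = 1" for t using N by (simp add: C_def)
  have power: "act (C (real n * \<theta>)) = g ^^ n" for n
  proof (induction n)
    case 0
    thus ?case by (auto simp: C0)
  next
    case (Suc n)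
    have "C (real (Suc n) * \<theta>) = C \<theta> \<odot> C (real n * \<theta>)"
      by (simp add: C_add algebra_simps)
    hence "act (C (real (Suc n) * \<theta>)) = act (C \<theta>) \<circ> act (C (real n * \<theta>))"
      by (auto simp: act_mmul detC)
    moreover have "act (C \<theta>) = g" using A AN by (simp add: C_def)
    ultimately show ?case using Suc by simp
  qed
  have gn: "g ^^ n \<in> \<Gamma>" for n
    by (induction n) (simp_all only: funpow.simps id_mem comp_mem g)
  have "continuous_on UNIV C"
    unfolding C_def rot_def by (intro continuous_intros)
  moreover obtain e where e: "e > 0" "\<And>B. B \<in> mats \<Longrightarrow> dist B mone < e \<Longrightarrow> B = mone"
  proof -
    have "mone \<in> mats" using id_mem by (simp add: mats_def id_def act_mone[abs_def])
    thus thesis using mats_isolated that by blast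
  qed
  ultimately obtain \<delta> where \<delta>: "\<delta> > 0" "\<And>t. \<bar>t\<bar> < \<delta> \<Longrightarrow> dist (C t) mone < e"
    unfolding continuous_on_iff C0[symmetric] by (metis UNIV_I dist_0_norm dist_commute real_norm_def)
  obtain K where K: "K > 0" "1 / real K < \<delta> / (2 * pi)"
    using \<delta>(1) reals_Archimedean[of "\<delta> / (2 * pi)"] by (metis inverse_eq_divide zero_less_Suc divide_pos_pos mult_pos_pos pi_gt_zero zero_less_numeral)
  \<comment> \<open>Dirichlet approximation: \<open>of_int k * \<theta>\<close> is within
    \<open>\<delta>\<close> of a multiple of \<open>2 * pi\<close>, so the \<open>k\<close>-th power
    is near the identity, hence equal to it.\<close>
  obtain m k where mk: "k > 0" "\<bar>of_int k * (\<theta> / (2 * pi)) - of_int m\<bar> < 1 / real K"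
    using Dirichlet_approx[OF K(1)] by metis
  define t where "t = of_int k * \<theta> - 2 * pi * of_int m"
  have "\<bar>t\<bar> = 2 * pi * \<bar>of_int k * (\<theta> / (2 * pi)) - of_int m\<bar>"
  proof -
    have "t = 2 * pi * (of_int k * (\<theta> / (2 * pi)) - of_int m)"
      by (simp add: t_def right_diff_distrib)
    thus ?thesis by (simp only: abs_mult) simp
  qed
  also have "\<dots> < 2 * pi * (\<delta> / (2 * pi))"
    by (intro mult_strict_left_mono order.strict_trans[OF mk(2) K(2)]) simp
  finally have "\<bar>t\<bar> < \<delta>" by simp
  moreover have "C t = C (real (nat k) * \<theta>)"
  proof -
    have "cos (2 * pi * of_int m) = 1" "sin (2 * pi * of_int m) = 0"
      by (simp_all add: cos_one_2pi_int sin_zero_iff_int2)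
    thus ?thesis using mk(1) by (simp add: C_def rot_def t_def sin_diff cos_diff)
  qed
  ultimately have "dist (C (real (nat k) * \<theta>)) mone < e" using \<delta>(2) by metis
  moreover have "C (real (nat k) * \<theta>) \<in> mats"
    using detC power gn by (simp add: mats_def)
  ultimately have "C (real (nat k) * \<theta>) = mone" using e(2) by blast
  hence "g ^^ nat k = id" using power[of "nat k"] by (auto simp: fun_eq_iff)
  thus "g = id" using torsion_free[OF g, of "nat k"] mk(1) by simp
qed

text \<open>A trace of absolute value below \<open>2\<close> gives a fixed point; only the identity
  of \<open>\<Gamma>\<close> has one, and its matrices have trace \<open>2\<close> and
  \<open>-2\<close>.\<close>

lemma mats_trace:
  assumes "A \<in> mats"
  shows "\<bar>mtrace A\<bar> \<ge> 2"
proof (rule ccontr)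
  assume neg: "\<not> ?thesis"
  then obtain x where "act A x = x" using elliptic_fixes[of A] assms by (auto simp: mats_def)
  hence "act A = id" using fixed_point_free assms by (auto simp: mats_def)
  hence "A = mone \<or> A = - mone" using assms act_fixes_iaxis_imp by (simp add: mats_def)
  thus False using neg by (auto simp: mone_def)
qed

text \<open>Conjugation by \<open>M\<close> lets any chosen line play the role of the imaginary
  axis.\<close>

lemma sl2_subgroup_conj:
  assumes M: "mdet M = 1"
  shows "sl2_subgroup {B. M \<odot> B \<odot> madj M \<in> mats}"
proof
  let ?c = "\<lambda>B. M \<odot> B \<odot> madj M"
  have can: "madj M \<odot> ?c B \<odot> M = B" for B
  proof -
    have "madj M \<odot> ?c B \<odot> M = (madj M \<odot> M) \<odot> B \<odot> (madj M \<odot> M)" by (simp only: mmul_assoc)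
    thus ?thesis using M by simp
  qed
  show det: "mdet A = 1" if "A \<in> {B. ?c B \<in> mats}" for A
    using that M by (simp add: mats_def)
  show "A \<odot> B \<in> {B. ?c B \<in> mats}" if "A \<in> {B. ?c B \<in> mats}" "B \<in> {B. ?c B \<in> mats}" for A B
  proof -
    have "?c A \<odot> ?c B = M \<odot> A \<odot> ((madj M \<odot> M) \<odot> (B \<odot> madj M))" by (simp only: mmul_assoc)
    hence eq: "?c A \<odot> ?c B = ?c (A \<odot> B)" using M by (simp add: mmul_assoc)
    show ?thesis using mats_mmul[of "?c A" "?c B"] that unfolding eq mem_Collect_eq by blast
  qed
  show "madj A \<in> {B. ?c B \<in> mats}" if "A \<in> {B. ?c B \<in> mats}" for A
  proof -
    have "madj (X \<odot> Y) = madj Y \<odot> madj X" for X Y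
      by (cases X; cases Y) (simp add: algebra_simps)
    hence eq: "madj (?c A) = ?c (madj A)" by (simp add: mmul_assoc)
    show ?thesis using mats_madj[of "?c A"] that unfolding eq mem_Collect_eq by blast
  qed
  show "- A \<in> {B. ?c B \<in> mats}" if "A \<in> {B. ?c B \<in> mats}" for A
  proof -
    have eq: "?c (- A) = - ?c A" by (cases M; cases A) (simp add: algebra_simps)
    show ?thesis using mats_uminus[of "?c A"] that unfolding eq mem_Collect_eq by blast
  qed
  show "\<bar>mtrace A\<bar> \<ge> 2" if "A \<in> {B. ?c B \<in> mats}" for A
  proof -
    have "mtrace (?c A) = mtrace (madj M \<odot> M \<odot> A)"
      by (subst mtrace_commute) (simp add: mmul_assoc)
    thus ?thesis using that mats_trace[of "?c A"] M by simp
  qed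
  show "\<exists>e>0. \<forall>A\<in>{B. ?c B \<in> mats}. dist A mone < e \<longrightarrow> A = mone"
  proof -
    have "mone \<in> mats" using id_mem by (simp add: mats_def id_def act_mone[abs_def])
    then obtain e where e: "e > 0" "\<And>B. B \<in> mats \<Longrightarrow> dist B mone < e \<Longrightarrow> B = mone"
      using mats_isolated by blast
    have 1: "?c mone = mone" using M by simp
    have "continuous_on UNIV ?c" by (intro continuous_intros)
    then obtain d where d: "d > 0" "\<And>B. dist B mone < d \<Longrightarrow> dist (?c B) (?c mone) < e"
      using e(1) unfolding continuous_on_iff by blast
    have "A = mone" if "?c A \<in> mats" "dist A mone < d" for A
    proof -
      have "?c A = mone" using that e(2) d(2) 1 by metis
      thus ?thesis using can[of A] M by simp
    qed
    thus ?thesis using d(1) by blast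
  qed
qed

text \<open>Two lifts differ at every time by an element of the countable group \<open>\<Gamma>\<close>, so the same
  element occurs at two different times.\<close>
lemma lifts_differ_by_deck:
  assumes "geodesic_param \<alpha>" "geodesic_param \<beta>" "\<And>t. covering_proj \<Gamma> (\<alpha> t) = covering_proj \<Gamma> (\<beta> t)"
  shows "\<exists>g\<in>\<Gamma>. \<forall>t. \<beta> t = g (\<alpha> t)"
proof (rule ccontr)
  assume neg: "\<not> ?thesis"
  \<comment> \<open>A deck transformation matching the two lifts at two times would match them at
    all times.\<close>
  have "a = b" if "g \<in> \<Gamma>" "\<beta> a = g (\<alpha> a)" "\<beta> b = g (\<alpha> b)" for g a b
    using geodesic_param_unique[OF assms(2) geodesic_param_comp[OF that(1) assms(1)], of a b] that neg
    by metis
  hence "{t. \<beta> t = g (\<alpha> t)} \<subseteq> {a}" if "g \<in> \<Gamma>" "\<beta> a = g (\<alpha> a)" for g a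
    using that by auto
  hence "finite {t. \<beta> t = g (\<alpha> t)}" if g: "g \<in> \<Gamma>" for g
  proof (cases "\<exists>a. \<beta> a = g (\<alpha> a)")
    case True
    then obtain a where "{t. \<beta> t = g (\<alpha> t)} \<subseteq> {a}"
      using \<open>\<And>g a. g \<in> \<Gamma> \<Longrightarrow> \<beta> a = g (\<alpha> a) \<Longrightarrow> {t. \<beta> t = g (\<alpha> t)} \<subseteq> {a}\<close> g by metis
    thus ?thesis by (rule finite_subset) simp
  qed simp
  hence "countable (\<Union>g\<in>\<Gamma>. {t. \<beta> t = g (\<alpha> t)})"
    using countable_group by (intro countable_UN) (auto intro: countable_finite)
  moreover have "\<exists>g\<in>\<Gamma>. \<beta> t = g (\<alpha> t)" for t
  proof -
    have "\<beta> t \<in> covering_proj \<Gamma> (\<alpha> t)"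
      unfolding assms(3) unfolding covering_proj_def by (rule image_eqI[of _ _ id]) (simp_all add: id_mem)
    thus ?thesis by (auto simp: covering_proj_def)
  qed
  hence "(\<Union>g\<in>\<Gamma>. {t. \<beta> t = g (\<alpha> t)}) = UNIV" by blast
  ultimately show False using uncountable_UNIV_real by simp
qed

text \<open>A lift of \<open>\<gamma>\<close> and its time shift by the period \<open>l\<close>
  cover the same curve, so a deck transformation moves the lift along itself by \<open>l\<close>.
  Conjugated to the axis it is \<open>diag l\<close> up to sign.\<close>

lemma closed_geodesic_translation:
  assumes "closed_geodesic \<Gamma> l \<gamma>" "mdet M = 1" "\<And>t. covering_proj \<Gamma> (act M (iaxis t)) = \<gamma> t"
  shows "M \<odot> diag l \<odot> madj M \<in> mats"
proof -
  have "geodesic_param (\<lambda>t. act M (iaxis (1 * t + l)))"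
    using geodesic_param_affine[OF geodesic_param_act_iaxis[OF assms(2)], of 1 l] by simp
  then obtain g where g: "g \<in> \<Gamma>" "\<And>t. act M (iaxis (t + l)) = g (act M (iaxis t))"
    using lifts_differ_by_deck[OF geodesic_param_act_iaxis[OF assms(2)], of "\<lambda>t. act M (iaxis (t + l))"]
      assms(1,3) unfolding closed_geodesic_def by auto
  obtain A where A: "mdet A = 1" "g = act A" using ex_matrix[OF g(1)] by blast
  define B where "B = diag (- l) \<odot> madj M \<odot> A \<odot> M"
  have detB: "mdet B = 1" using A assms(2) by (simp add: B_def)
  have "act B (iaxis t) = iaxis t" for t
  proof -
    have "act A (act M (iaxis t)) = act M (iaxis (t + l))" using g(2) A(2) by simp
    thus ?thesis using A(1) assms(2) by (simp add: B_def act_mmul)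
  qed
  hence "B = mone \<or> B = - mone" using detB by (intro act_fixes_iaxis_imp) auto
  moreover have "A = M \<odot> diag l \<odot> B \<odot> madj M"
  proof -
    have "M \<odot> diag l \<odot> B \<odot> madj M = M \<odot> ((diag l \<odot> diag (- l)) \<odot> (madj M \<odot> (A \<odot> (M \<odot> madj M))))"
      by (simp only: B_def mmul_assoc)
    also have "\<dots> = (M \<odot> madj M) \<odot> A" using assms(2)
      by (simp add: diag_mmul mmul_assoc[symmetric, of M "madj M" A])
    finally show ?thesis by (simp add: assms(2))
  qed
  moreover have "M \<odot> diag l \<odot> (- mone) \<odot> madj M = - (M \<odot> diag l \<odot> madj M)"
    by (cases M) (simp add: diag_def mone_def algebra_simps)
  ultimately have "M \<odot> diag l \<odot> madj M = A \<or> M \<odot> diag l \<odot> madj M = - A" by auto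
  moreover have "A \<in> mats" using A g by (simp add: mats_def)
  ultimately show ?thesis using mats_uminus[of A] by metis
qed

end

section \<open>Orthogonal projection to the imaginary axis, along the half circles centred at
  0\<close>

definition height :: "hyp_plane \<Rightarrow> real" where
  "height x = ln (cmod (coord x))"

lemma height_iaxis [simp]: "height (iaxis t) = t"
proof -
  have "cmod (Complex 0 (exp t)) = exp t" by (simp add: cmod_def)
  thus ?thesis by (simp add: height_def)
qed

lemma cmod_act_iaxis:
  assumes "mdet (p, q, r, s) = 1"
  shows "(cmod (coord (act (p, q, r, s) (iaxis t))))\<^sup>2 = (p\<^sup>2 * exp (2 * t) + q\<^sup>2) / (r\<^sup>2 * exp (2 * t) + s\<^sup>2)"
    and "r\<^sup>2 * exp (2 * t) + s\<^sup>2 > 0" "p\<^sup>2 * exp (2 * t) + q\<^sup>2 > 0"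
proof -
  have dt: "p * s - q * r = 1" using assms by simp
  have pos: "a\<^sup>2 * exp (2 * t) + b\<^sup>2 > 0" if "a \<noteq> 0 \<or> b \<noteq> 0" for a b :: real
    using that by (auto intro: add_pos_nonneg add_nonneg_pos)
  show "r\<^sup>2 * exp (2 * t) + s\<^sup>2 > 0" "p\<^sup>2 * exp (2 * t) + q\<^sup>2 > 0"
    using dt by (auto intro!: pos)
  have "(cmod (of_real a * Complex 0 (exp t) + of_real b))\<^sup>2 = a\<^sup>2 * exp (2 * t) + b\<^sup>2" for a b
    by (simp add: cmod_power2 power_mult_distrib exp_double)
  thus "(cmod (coord (act (p, q, r, s) (iaxis t))))\<^sup>2 = (p\<^sup>2 * exp (2 * t) + q\<^sup>2) / (r\<^sup>2 * exp (2 * t) + s\<^sup>2)"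
    using assms by (simp only: coord_act coord_iaxis mob.simps norm_divide power_divide)
qed

lemma height_diff_less:
  assumes "E > 0" "(cmod (coord x))\<^sup>2 < E * (cmod (coord y))\<^sup>2"
  shows "2 * (height x - height y) < ln E"
proof -
  have nz: "cmod (coord z) > 0" for z using Im_coord_pos[of z] by auto
  have "ln ((cmod (coord x))\<^sup>2) < ln (E * (cmod (coord y))\<^sup>2)"
    using assms nz by (subst ln_less_cancel_iff) auto
  thus ?thesis using assms nz[of x] nz[of y] by (simp add: height_def ln_mult ln_realpow)
qed

text \<open>The quotient of two squared moduli on the line is bounded by \<open>E\<close> after
  cross multiplication: the coefficients of \<open>X\<close> and \<open>Y\<close> compare by the two
  hypotheses, the other terms by \<open>E \<ge> 1\<close>.\<close>

lemma height_act_less: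
  assumes "mdet (p, q, r, s) = 1" "\<bar>p * s\<bar> < exp l * \<bar>q * r\<bar>" "\<bar>q * r\<bar> < exp l * \<bar>p * s\<bar>"
  shows "height (act (p, q, r, s) (iaxis t)) - height (act (p, q, r, s) (iaxis u)) < l"
proof -
  let ?A = "(p, q, r, s)"
  define X where "X = exp (2 * t)"
  define Y where "Y = exp (2 * u)"
  define E where "E = exp (2 * l)"
  have XY: "X > 0" "Y > 0" by (simp_all add: X_def Y_def)
  have "\<bar>p * s\<bar>\<^sup>2 < (exp l * \<bar>q * r\<bar>)\<^sup>2" "\<bar>q * r\<bar>\<^sup>2 < (exp l * \<bar>p * s\<bar>)\<^sup>2"
    using assms by (intro power_strict_mono; simp)+
  hence sq: "p\<^sup>2 * s\<^sup>2 < E * (q\<^sup>2 * r\<^sup>2)" "q\<^sup>2 * r\<^sup>2 < E * (p\<^sup>2 * s\<^sup>2)"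
    by (simp_all add: power_mult_distrib E_def flip: exp_double)
  \<comment> \<open>For \<open>E < 1\<close> the two inequalities \<open>sq\<close> would form a
    cycle.\<close>
  have "E \<ge> 1"
  proof (rule ccontr)
    assume "\<not> E \<ge> 1"
    hence "E * (q\<^sup>2 * r\<^sup>2) \<le> q\<^sup>2 * r\<^sup>2" "E * (p\<^sup>2 * s\<^sup>2) \<le> p\<^sup>2 * s\<^sup>2"
      by (auto intro!: mult_left_le_one_le simp: E_def)
    thus False using sq by linarith
  qed
  have "(p\<^sup>2 * X + q\<^sup>2) * (r\<^sup>2 * Y + s\<^sup>2) = p\<^sup>2 * r\<^sup>2 * X * Y + (p\<^sup>2 * s\<^sup>2) * X + (q\<^sup>2 * r\<^sup>2) * Y + q\<^sup>2 * s\<^sup>2"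
    by (simp add: algebra_simps)
  also have "\<dots> < E * (p\<^sup>2 * r\<^sup>2 * X * Y) + (E * (q\<^sup>2 * r\<^sup>2)) * X + (E * (p\<^sup>2 * s\<^sup>2)) * Y + E * (q\<^sup>2 * s\<^sup>2)"
  proof -
    have ge: "x \<le> E * x" if "x \<ge> 0" for x using mult_right_mono[OF \<open>E \<ge> 1\<close> that] by simp
    have "p\<^sup>2 * r\<^sup>2 * X * Y \<le> E * (p\<^sup>2 * r\<^sup>2 * X * Y)" "q\<^sup>2 * s\<^sup>2 \<le> E * (q\<^sup>2 * s\<^sup>2)"
      using XY by (intro ge; simp)+
    thus ?thesis
      using mult_strict_right_mono[OF sq(1) XY(1)] mult_strict_right_mono[OF sq(2) XY(2)] by linarith
  qed
  also have "\<dots> = E * ((p\<^sup>2 * Y + q\<^sup>2) * (r\<^sup>2 * X + s\<^sup>2))"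
    by (simp add: algebra_simps)
  finally have "(p\<^sup>2 * X + q\<^sup>2) / (r\<^sup>2 * X + s\<^sup>2) < E * ((p\<^sup>2 * Y + q\<^sup>2) / (r\<^sup>2 * Y + s\<^sup>2))"
    using cmod_act_iaxis(2)[OF assms(1), of t] cmod_act_iaxis(2)[OF assms(1), of u]
    unfolding X_def[symmetric] Y_def[symmetric] by (simp add: field_simps)
  hence "2 * (height (act ?A (iaxis t)) - height (act ?A (iaxis u))) < ln E"
    by (intro height_diff_less)
      (simp_all only: cmod_act_iaxis(1)[OF assms(1)] X_def[symmetric] Y_def[symmetric] E_def exp_gt_zero)
  thus ?thesis by (simp add: E_def)
qed

text \<open>Where the line crosses the imaginary axis, its height is the mean of the heights of its endpoints
  \<open>q / s\<close> and \<open>p / r\<close>.\<close>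
lemma height_act_crossing_less:
  assumes "mdet (p, q, r, s) = 1" "\<bar>p * s\<bar> < exp l * \<bar>q * r\<bar>" "\<bar>q * r\<bar> < exp l * \<bar>p * s\<bar>"
    and u: "act (p, q, r, s) (iaxis u) \<in> range iaxis"
  shows "\<bar>height (act (p, q, r, s) (iaxis t)) - height (act (p, q, r, s) (iaxis u))\<bar> < l / 2"
proof -
  let ?A = "(p, q, r, s)"
  define X where "X = exp (2 * t)"
  define Y where "Y = exp (2 * u)"
  have XY: "X > 0" "Y > 0" by (simp_all add: X_def Y_def)
  have nz: "p \<noteq> 0" "q \<noteq> 0" "r \<noteq> 0" "s \<noteq> 0"
    using assms(2,3) by (auto simp: not_less)
  have dt: "p * s - q * r = 1" using assms(1) by simp
  have "Re (mob ?A (Complex 0 (exp u))) = 0"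
    using u assms(1) by (metis coord_act coord_iaxis complex.sel(1) imageE)
  hence "q * s + p * r * (exp u * exp u) = 0 \<or> (r * exp u)\<^sup>2 + s\<^sup>2 = 0"
    by (simp add: Re_divide power2_eq_square algebra_simps)
  \<comment> \<open>The crossing condition: the real part vanishes at time \<open>u\<close>.\<close>
  hence Y: "p * r * Y = - (q * s)"
    using nz by (auto simp: Y_def sum_power2_eq_zero_iff simp flip: exp_add)
  define D where "D = r\<^sup>2 * Y + s\<^sup>2"
  define N where "N = p\<^sup>2 * Y + q\<^sup>2"
  \<comment> \<open>The squared modulus \<open>N / D\<close> at the crossing is therefore the
    geometric mean of the squares of the endpoints.\<close>
  have D: "D = s / p" "N = - (q / r)"
  proof -
    have "p * D = r * (p * r * Y) + p * s\<^sup>2" by (simp add: D_def power2_eq_square algebra_simps)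
    also have "\<dots> = s" unfolding Y using dt by algebra
    finally show "D = s / p" using nz by (simp add: field_simps)
    have "r * N = p * (p * r * Y) + r * q\<^sup>2" by (simp add: N_def power2_eq_square algebra_simps)
    also have "\<dots> = - q" unfolding Y using dt by algebra
    finally show "N = - (q / r)" using nz by (simp add: field_simps)
  qed
  have pos: "D > 0" "N > 0" "r\<^sup>2 * X + s\<^sup>2 > 0"
    using cmod_act_iaxis(2,3)[OF assms(1)] by (auto simp: D_def N_def X_def Y_def)
  have sp: "s * p > 0" "q * r < 0"
    using pos unfolding D by (auto simp: zero_less_divide_iff divide_less_0_iff mult_less_0_iff zero_less_mult_iff)
  have b: "p * s < exp l * - (q * r)" "- (q * r) < exp l * (p * s)"
    using assms(2,3) sp by (simp_all add: abs_if mult.commute)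
  \<comment> \<open>Coefficients of a comparison of squared moduli in both directions; the factor is
    \<open>exp l\<close>, which gives \<open>l / 2\<close> for the heights.\<close>
  have c: "p\<^sup>2 * D < exp l * N * r\<^sup>2" "q\<^sup>2 * D < exp l * N * s\<^sup>2"
    "N * r\<^sup>2 < exp l * (p\<^sup>2 * D)" "N * s\<^sup>2 < exp l * (q\<^sup>2 * D)"
  proof -
    have e: "p\<^sup>2 * D = p * s" "N * r\<^sup>2 = - (q * r)"
      using nz by (simp_all add: D power2_eq_square)
    show "p\<^sup>2 * D < exp l * N * r\<^sup>2" "N * r\<^sup>2 < exp l * (p\<^sup>2 * D)"
      using b e by (simp_all add: mult.assoc)
    have "q\<^sup>2 * D = - (q * r) * (- (q * s) / (p * r))" "N * s\<^sup>2 = (p * s) * (- (q * s) / (p * r))"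
      using nz by (simp_all add: D power2_eq_square field_simps)
    moreover have "- (q * s) / (p * r) = Y" using Y nz by (simp add: field_simps)
    ultimately have e: "q\<^sup>2 * D = - (q * r) * Y" "N * s\<^sup>2 = (p * s) * Y" by metis+
    show "q\<^sup>2 * D < exp l * N * s\<^sup>2" "N * s\<^sup>2 < exp l * (q\<^sup>2 * D)"
      using mult_strict_right_mono[OF b(1) XY(2)] mult_strict_right_mono[OF b(2) XY(2)]
      by (simp_all add: e mult.assoc)
  qed
  have "(p\<^sup>2 * X + q\<^sup>2) * D < exp l * N * (r\<^sup>2 * X + s\<^sup>2)"
    using mult_strict_right_mono[OF c(1) XY(1)] c(2) by (simp add: algebra_simps)
  hence "(p\<^sup>2 * X + q\<^sup>2) / (r\<^sup>2 * X + s\<^sup>2) < exp l * (N / D)"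
    using pos by (simp add: field_simps)
  moreover have "N * (r\<^sup>2 * X + s\<^sup>2) < exp l * ((p\<^sup>2 * X + q\<^sup>2) * D)"
    using mult_strict_right_mono[OF c(3) XY(1)] c(4) by (simp add: algebra_simps)
  hence "N / D < exp l * ((p\<^sup>2 * X + q\<^sup>2) / (r\<^sup>2 * X + s\<^sup>2))"
    using pos by (simp add: field_simps)
  ultimately have "2 * (height (act ?A (iaxis t)) - height (act ?A (iaxis u))) < ln (exp l)"
    "2 * (height (act ?A (iaxis u)) - height (act ?A (iaxis t))) < ln (exp l)"
    unfolding N_def D_def X_def Y_def cmod_act_iaxis(1)[OF assms(1), symmetric]
    using height_diff_less[OF exp_gt_zero] by blast+
  thus ?thesis by (simp add: abs_if)
qed

text \<open>Up to sign a diagonal matrix is a translation along the axis. Hence a different line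
  comes from a matrix with a nonzero entry off the diagonal.\<close>

lemma range_act_diagonal:
  assumes "mdet (p, 0, 0, s) = 1"
  shows "act (p, 0, 0, s) ` range iaxis = range iaxis"
proof -
  have ps: "p * s = 1" using assms by simp
  hence p: "p \<noteq> 0" by auto
  define t where "t = 2 * ln \<bar>p\<bar>"
  have s: "s = 1 / p" using ps p by (simp add: field_simps)
  have "diag t = (\<bar>p\<bar>, 0, 0, 1 / \<bar>p\<bar>)" using p by (simp add: diag_def t_def exp_minus inverse_eq_divide)
  hence "(p, 0, 0, s) = diag t \<or> (p, 0, 0, s) = - diag t"
    using p s by (cases "p > 0") (auto simp: abs_if)
  hence "act (p, 0, 0, s) x = act (diag t) x" for x by auto
  hence "act (p, 0, 0, s) ` range iaxis = range (\<lambda>u. iaxis (u + t))"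
    by (simp add: image_image)
  also have "\<dots> = range iaxis"
  proof -
    have "iaxis u = iaxis ((u - t) + t)" for u by simp
    thus ?thesis by blast
  qed
  finally show ?thesis .
qed

text \<open>For a line above \<open>\<gamma>\<close>, the function \<open>f\<close> is the orthogonal projection to that line, read in an
  arc length parametrisation of the line.\<close>
lemma (in oriented_surface) ex_line_above_projection:
  assumes cg: "closed_geodesic \<Gamma> l \<gamma>" and la: "line_above \<Gamma> \<gamma> \<Lambda>"
  shows "\<exists>f. (\<forall>x\<in>\<Lambda>. \<forall>y\<in>\<Lambda>. \<bar>f x - f y\<bar> = dist x y) \<and>
    (\<forall>\<Lambda>'. line_above \<Gamma> \<gamma> \<Lambda>' \<and> \<Lambda>' \<noteq> \<Lambda> \<longrightarrow> (\<forall>x\<in>\<Lambda>'. \<forall>y\<in>\<Lambda>'. \<bar>f x - f y\<bar> < l \<and> 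
      (x \<in> \<Lambda> \<longrightarrow> \<bar>f x - f y\<bar> < l / 2)))"
proof -
  have l: "l > 0" using cg by (simp add: closed_geodesic_def)
  obtain \<alpha> where \<alpha>: "geodesic_param \<alpha>" "\<And>t. covering_proj \<Gamma> (\<alpha> t) = \<gamma> t" "\<Lambda> = range \<alpha>"
    using la unfolding line_above_def by blast
  obtain M where M: "mdet M = 1" "\<And>t. \<alpha> t = act M (iaxis t)"
    using geodesic_paramE[OF \<alpha>(1)] by blast
  define f where "f x = height (act (madj M) x)" for x
  have f\<alpha>: "f (\<alpha> t) = t" for t using M by (simp add: f_def)
  interpret G: sl2_subgroup "{B. M \<odot> B \<odot> madj M \<in> mats}"
    by (rule sl2_subgroup_conj[OF M(1)])
  have dl: "diag l \<in> {B. M \<odot> B \<odot> madj M \<in> mats}"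
    using closed_geodesic_translation[OF cg M(1)] \<alpha>(2) M(2) by simp
  have \<Lambda>: "\<Lambda> = act M ` range iaxis" using \<alpha>(3) M(2) by auto
  have other: "\<exists>p q r s. mdet (p, q, r, s) = 1 \<and> \<bar>p * s\<bar> < exp l * \<bar>q * r\<bar> \<and> \<bar>q * r\<bar> < exp l * \<bar>p * s\<bar> \<and>
      \<Lambda>' = (\<lambda>t. act M (act (p, q, r, s) (iaxis t))) ` UNIV" 
    if \<Lambda>': "line_above \<Gamma> \<gamma> \<Lambda>'" "\<Lambda>' \<noteq> \<Lambda>" for \<Lambda>'
  proof -
    obtain \<beta> where \<beta>: "geodesic_param \<beta>" "\<And>t. covering_proj \<Gamma> (\<beta> t) = \<gamma> t" "\<Lambda>' = range \<beta>"
      using \<Lambda>'(1) unfolding line_above_def by blast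
    obtain g where g: "g \<in> \<Gamma>" "\<And>t. \<beta> t = g (\<alpha> t)"
      using lifts_differ_by_deck[OF \<alpha>(1) \<beta>(1)] \<alpha>(2) \<beta>(2) by auto
    obtain A where A: "mdet A = 1" "g = act A" using ex_matrix[OF g(1)] by blast
    \<comment> \<open>The deck transformation from \<open>\<Lambda>\<close> to
      \<open>\<Lambda>'\<close>, in coordinates where \<open>\<Lambda>\<close> is the imaginary
      axis.\<close>
    define B where "B = madj M \<odot> A \<odot> M"
    obtain p q r s where B: "B = (p, q, r, s)" by (cases B)
    have dB: "mdet B = 1" using A M by (simp add: B_def)
    have "M \<odot> B \<odot> madj M = (M \<odot> madj M) \<odot> A \<odot> (M \<odot> madj M)"
      by (simp only: B_def mmul_assoc)
    hence "M \<odot> B \<odot> madj M \<in> mats" using A M g by (simp add: mats_def)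
    hence BG: "(p, q, r, s) \<in> {B. M \<odot> B \<odot> madj M \<in> mats}" by (simp add: B)
    have "\<beta> t = act M (act B (iaxis t))" for t
      using g(2) A M by (simp add: B_def act_mmul)
    hence \<Lambda>'_eq: "\<Lambda>' = (\<lambda>t. act M (act B (iaxis t))) ` UNIV" using \<beta>(3) by simp
    have "q \<noteq> 0 \<or> r \<noteq> 0"
    proof (rule ccontr)
      assume "\<not> ?thesis"
      hence "act B ` range iaxis = range iaxis"
        using range_act_diagonal[of p s] dB by (simp add: B)
      hence "act M ` act B ` range iaxis = \<Lambda>" using \<Lambda> by simp
      thus False using \<Lambda>'(2) \<Lambda>'_eq by (simp add: image_image)
    qed
    thus ?thesis
      using G.off_diagonal_lower_bound[OF dl l BG] G.diagonal_lower_bound[OF dl l BG] dB \<Lambda>'_eq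
      unfolding B by blast
  qed
  show ?thesis
  proof (intro exI[of _ f] conjI ballI allI impI)
    show "\<bar>f x - f y\<bar> = dist x y" if "x \<in> \<Lambda>" "y \<in> \<Lambda>" for x y
      using that \<alpha>(1) unfolding \<alpha>(3) geodesic_param_def by (auto simp: f\<alpha>)
  next
    fix \<Lambda>' x y assume "line_above \<Gamma> \<gamma> \<Lambda>' \<and> \<Lambda>' \<noteq> \<Lambda>" and xy: "x \<in> \<Lambda>'" "y \<in> \<Lambda>'"
    hence h: "line_above \<Gamma> \<gamma> \<Lambda>'" "\<Lambda>' \<noteq> \<Lambda>" "x \<in> \<Lambda>'" "y \<in> \<Lambda>'" by auto
    obtain p q r s where B: "mdet (p, q, r, s) = 1" "\<bar>p * s\<bar> < exp l * \<bar>q * r\<bar>" "\<bar>q * r\<bar> < exp l * \<bar>p * s\<bar>"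
      "\<Lambda>' = (\<lambda>t. act M (act (p, q, r, s) (iaxis t))) ` UNIV"
      using other[OF h(1,2)] by blast
    obtain t u where tu: "x = act M (act (p, q, r, s) (iaxis t))" "y = act M (act (p, q, r, s) (iaxis u))"
      using h(3,4) unfolding B(4) by blast
    have fxy: "f x = height (act (p, q, r, s) (iaxis t))" "f y = height (act (p, q, r, s) (iaxis u))"
      using M(1) by (simp_all add: f_def tu)
    show "\<bar>f x - f y\<bar> < l"
      using height_act_less[OF B(1-3), of t u] height_act_less[OF B(1-3), of u t]
      unfolding fxy by linarith
    assume "x \<in> \<Lambda>"
    hence "act (p, q, r, s) (iaxis t) \<in> range iaxis"
      using M(1) unfolding \<Lambda> tu by (metis (no_types, lifting) act_madj(1) imageE)
    thus "\<bar>f x - f y\<bar> < l / 2"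
      using height_act_crossing_less[OF B(1-3), of t u] unfolding fxy by (simp add: abs_minus_commute)
  qed
qed

section \<open>Polygons\<close>

text \<open>The hyperbolic law of cosines at \<open>iaxis 0\<close> with angle
  \<open>2 * \<phi>\<close>, written as a convex combination of the two collinear cases.\<close>

lemma cosh_dist_rot:
  "cosh (dist (act (rot \<phi>) (iaxis a)) (iaxis b)) = (cos \<phi>)\<^sup>2 * cosh (a - b) + (sin \<phi>)\<^sup>2 * cosh (a + b)"
proof -
  let ?z = "act (rot \<phi>) (iaxis a)"
  define A where "A = exp a"
  define B where "B = exp b"
  have AB: "A > 0" "B > 0" by (simp_all add: A_def B_def)
  define c where "c = cos \<phi>"
  define s where "s = sin \<phi>"
  have dt: "mdet (c, s, - s, c) = 1" by (simp add: c_def s_def flip: power2_eq_square)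
  have rot: "rot \<phi> = (c, s, - s, c)" by (simp add: rot_def c_def s_def)
  define D where "D = s\<^sup>2 * A\<^sup>2 + c\<^sup>2"
  have D: "D > 0" using cmod_act_iaxis(2)[OF dt, of a] by (simp add: D_def A_def exp_double)
  have "(cmod (coord ?z))\<^sup>2 = (c\<^sup>2 * A\<^sup>2 + s\<^sup>2) / D"
    using cmod_act_iaxis(1)[OF dt, of a] by (simp add: rot D_def A_def exp_double)
  hence 1: "(Re (coord ?z))\<^sup>2 + (Im (coord ?z))\<^sup>2 = (c\<^sup>2 * A\<^sup>2 + s\<^sup>2) / D"
    by (simp add: cmod_power2)
  have "(cmod (of_real (- s) * Complex 0 A + of_real c))\<^sup>2 = D"
    by (simp add: cmod_power2 D_def power_mult_distrib)
  hence 2: "Im (coord ?z) = A / D"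
    using Im_mob[of c c s "- s" "Complex 0 A"] dt by (simp add: rot A_def del: mob.simps)
  have "cosh (dist ?z (iaxis b)) = ((c\<^sup>2 * A\<^sup>2 + s\<^sup>2) / D + B\<^sup>2) / (2 * (A / D) * B)"
    unfolding cosh_dist_eq[symmetric] coord_iaxis cosh_dist_iaxis[OF Im_coord_pos]
    by (simp only: 1[unfolded 2] 2 B_def exp_double)
  also have "\<dots> = (c\<^sup>2 * A\<^sup>2 + s\<^sup>2 + B\<^sup>2 * D) / (2 * A * B)"
    using D AB by (simp add: field_simps)
  also have "\<dots> = c\<^sup>2 * ((A / B + B / A) / 2) + s\<^sup>2 * ((A * B + 1 / (A * B)) / 2)"
    using AB by (simp add: D_def field_simps power2_eq_square)
  also have "(A / B + B / A) / 2 = cosh (a - b)"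
    by (simp add: cosh_def A_def B_def exp_diff exp_minus field_simps)
  also have "(A * B + 1 / (A * B)) / 2 = cosh (a + b)"
    by (simp only: A_def B_def cosh_field_def exp_minus inverse_eq_divide exp_add)
  finally show ?thesis by (simp add: c_def s_def)
qed

text \<open>Polar coordinates at \<open>\<alpha> r\<close>: points close to \<open>\<alpha> s\<close> lie on segments from \<open>\<alpha> r\<close> to points close
  to \<open>\<alpha> t\<close>.\<close>
lemma geodesically_convex_interior:
  assumes conv: "geodesically_convex P" and \<alpha>: "geodesic_param \<alpha>"
    and "\<alpha> r \<in> P" "\<alpha> t \<in> interior P" "r < s" "s < t"
  shows "\<alpha> s \<in> interior P"
proof -
  have "geodesic_param (\<lambda>u. \<alpha> (u + r))" using geodesic_param_affine[OF \<alpha>, of 1 r] by simp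
  from geodesic_paramE[OF this] obtain M where M: "mdet M = 1" "\<And>u. \<alpha> (u + r) = act M (iaxis u)"
    by blast
  define b where "b = s - r"
  define T where "T = t - r"
  have bT: "0 < b" "b < T" using assms(5,6) by (simp_all add: b_def T_def)
  have pts: "\<alpha> r = act M (iaxis 0)" "\<alpha> s = act M (iaxis b)" "\<alpha> t = act M (iaxis T)"
    using M(2)[of 0] M(2)[of b] M(2)[of T] by (simp_all add: b_def T_def)
  obtain e where e: "e > 0" "ball (\<alpha> t) e \<subseteq> P"
    using assms(4) by (meson mem_interior)
  have cb: "cosh b > 1" using bT cosh_real_strict_mono[of 0 b] by simp
  \<comment> \<open>Moving a point by \<open>d\<close> near distance \<open>b\<close> turns the ray
    from \<open>\<alpha> r\<close>; \<open>K\<close> bounds the resulting growth of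
    \<open>cosh - 1\<close> at distance \<open>T\<close>.\<close>
  define K where "K = (cosh (2 * T) - 1) / (cosh b - 1)"
  have K: "K > 0" using bT cb cosh_real_strict_mono[of 0 "2 * T"] by (simp add: K_def)
  have ce: "cosh e > 1" using e cosh_real_strict_mono[of 0 e] by simp
  have "((\<lambda>d. (cosh d - 1) * K) \<longlongrightarrow> (cosh 0 - 1) * K) (at_right (0::real))"
    by (intro tendsto_intros)
  hence "eventually (\<lambda>d. (cosh d - 1) * K < cosh e - 1) (at_right (0::real))"
    by (rule order_tendstoD) (use ce in simp)
  then obtain \<delta>' where \<delta>': "\<delta>' > 0" "\<And>d. d > 0 \<Longrightarrow> d < \<delta>' \<Longrightarrow> (cosh d - 1) * K < cosh e - 1"
    unfolding eventually_at_right_field by auto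
  \<comment> \<open>The second bound keeps the distance \<open>a\<close> of \<open>w\<close> from
    \<open>\<alpha> r\<close> below \<open>T\<close>, so that \<open>w\<close> comes before
    \<open>w'\<close> on its ray.\<close>
  define \<delta> where "\<delta> = min \<delta>' (T - b)"
  have \<delta>: "\<delta> > 0" using \<delta>' bT by (simp add: \<delta>_def)
  have "ball (\<alpha> s) \<delta> \<subseteq> P"
  proof
    fix w assume "w \<in> ball (\<alpha> s) \<delta>"
    hence wd: "dist (\<alpha> s) w < \<delta>" by simp
    define z where "z = act (madj M) w"
    have wz: "w = act M z" using M by (simp add: z_def)
    define a where "a = dist (iaxis 0) z"
    obtain A where A: "mdet A = 1" "act A (iaxis 0) = iaxis 0" "act A (iaxis a) = z"
      using ex_rotation[of z] unfolding a_def by blast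
    then obtain \<phi> where \<phi>: "A = rot \<phi>" using fixes_base_point_imp_rot by blast
    have a0: "a \<ge> 0" by (simp add: a_def)
    define d where "d = dist z (iaxis b)"
    have "dist (\<alpha> s) w = dist (iaxis b) z" using M by (simp add: pts wz)
    hence d\<delta>: "d < \<delta>" using wd by (simp add: d_def dist_commute)
    have "a \<le> b + d"
      using dist_triangle[of "iaxis 0" z "iaxis b"] bT by (simp add: a_def d_def dist_commute)
    hence aT: "a < T" using d\<delta> by (simp add: \<delta>_def)
    define \<sigma> where "\<sigma> = (sin \<phi>)\<^sup>2"
    have \<sigma>: "\<sigma> \<ge> 0" "(cos \<phi>)\<^sup>2 = 1 - \<sigma>" "\<sigma> \<le> 1" by (simp_all add: \<sigma>_def cos_squared_eq abs_square_le_1)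
    \<comment> \<open>The law of cosines bounds the turn \<open>\<sigma>\<close> by
      \<open>d\<close>: the first hyperbolic cosine is at least \<open>1\<close>, the second at
      least \<open>cosh b\<close>.\<close>
    have "cosh d = (1 - \<sigma>) * cosh (a - b) + \<sigma> * cosh (a + b)"
      using cosh_dist_rot[of \<phi> a b] \<sigma> A(3) by (simp add: \<phi> d_def \<sigma>_def)
    moreover have "(1 - \<sigma>) * 1 \<le> (1 - \<sigma>) * cosh (a - b)"
      using \<sigma> by (intro mult_left_mono) (auto simp: cosh_real_ge_1)
    moreover have "\<sigma> * cosh b \<le> \<sigma> * cosh (a + b)"
      using \<sigma> a0 bT by (intro mult_left_mono) (auto simp: cosh_real_nonneg_le_iff)
    ultimately have "\<sigma> * (cosh b - 1) \<le> cosh d - 1" by (simp add: algebra_simps)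
    hence \<sigma>d: "\<sigma> \<le> (cosh d - 1) / (cosh b - 1)" using cb by (simp add: field_simps)
    define w' where "w' = act M (act A (iaxis T))"
    have "cosh (dist w' (\<alpha> t)) = cosh (dist (act A (iaxis T)) (iaxis T))"
      using M by (simp add: w'_def pts)
    also have "\<dots> = 1 + \<sigma> * (cosh (2 * T) - 1)"
      using cosh_dist_rot[of \<phi> T T] \<sigma> by (simp add: \<phi> \<sigma>_def algebra_simps)
    also have "\<dots> \<le> 1 + (cosh d - 1) / (cosh b - 1) * (cosh (2 * T) - 1)"
      using \<sigma>d cosh_real_ge_1[of "2 * T"] by (intro add_left_mono mult_right_mono) auto
    also have "\<dots> = 1 + (cosh d - 1) * K" by (simp add: K_def)
    also have "\<dots> < cosh e"
    proof (cases "d = 0")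
      case False
      hence "d > 0" by (simp add: d_def)
      thus ?thesis using \<delta>'(2)[of d] d\<delta> by (simp add: \<delta>_def)
    qed (use ce in simp)
    finally have "dist w' (\<alpha> t) < e" using e(1) by (simp add: cosh_real_nonneg_less_iff)
    hence w'P: "w' \<in> P" using e(2) by (auto simp: dist_commute)
    have "dist (\<alpha> r) w = a" using M by (simp add: pts wz a_def)
    moreover have "dist w w' = T - a"
    proof -
      have "dist w w' = dist (act A (iaxis a)) (act A (iaxis T))" using M by (simp add: w'_def wz A(3))
      thus ?thesis using A(1) aT by simp
    qed
    moreover have "dist (\<alpha> r) w' = T"
    proof -
      have "dist (\<alpha> r) w' = dist (act A (iaxis 0)) (act A (iaxis T))" using M by (simp add: w'_def pts A(2))
      thus ?thesis using A(1) bT by simp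
    qed
    ultimately have "w \<in> geodesic_segment (\<alpha> r) w'" by (simp add: geodesic_segment_def)
    thus "w \<in> P" using conv assms(3) w'P unfolding geodesically_convex_def by blast
  qed
  thus ?thesis using \<delta> by (meson mem_interior)
qed

section \<open>Sides of convex polygons and their lines\<close>

lemma geodesic_segment_ends: "x \<in> geodesic_segment x y" "y \<in> geodesic_segment x y"
  by (simp_all add: geodesic_segment_def)

lemma geodesic_segment_commute: "geodesic_segment x y = geodesic_segment y x"
  by (auto simp: geodesic_segment_def dist_commute)

lemma closed_geodesic_segment: "closed (geodesic_segment x y)"
  unfolding geodesic_segment_def by (intro closed_Collect_eq continuous_intros)

lemma geodesic_param_in_segment_iff:
  assumes "geodesic_param \<alpha>" "a \<le> b"
  shows "\<alpha> t \<in> geodesic_segment (\<alpha> a) (\<alpha> b) \<longleftrightarrow> a \<le> t \<and> t \<le> b"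
  using assms by (auto simp: geodesic_segment_def geodesic_param_def)

lemma polygon_adjacent_sides:
  assumes "polygon n v P" "i < n" "k < n" "k = Suc i mod n \<or> i = Suc k mod n"
    and "geodesic_line \<Lambda>" "polygon_side n v i \<subseteq> \<Lambda>" "polygon_side n v k \<subseteq> \<Lambda>"
  shows False
proof -
  have *: "\<not> (\<exists>\<Lambda>. geodesic_line \<Lambda> \<and> polygon_side n v m \<union> polygon_side n v (Suc m mod n) \<subseteq> \<Lambda>)" if "m < n" for m
    using assms(1) that by (simp add: polygon_def)
  show False using assms(4)
  proof
    assume "k = Suc i mod n"
    thus False using *[OF assms(2)] assms(5-7) by auto
  next
    assume "i = Suc k mod n"
    thus False using *[OF assms(3)] assms(5-7) by auto
  qed
qed

lemma polygon_nonadjacent_sides: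
  assumes "polygon n v P" "i < n" "k < n" "k \<noteq> i" "k \<noteq> Suc i mod n" "i \<noteq> Suc k mod n"
  shows "polygon_side n v i \<inter> polygon_side n v k = {}"
  using assms by (simp add: polygon_def)

text \<open>Just beyond the end \<open>\<alpha> b\<close> of side \<open>i\<close> the line has left
  all sides but, by convexity, not \<open>P\<close>, so it is in the interior. Seen from
  \<open>\<alpha> a\<close>, the midpoint of the side is then interior too, although it lies on the
  frontier.\<close>

lemma polygon_sides_not_ordered_on_line:
  assumes poly: "polygon n v P" and conv: "geodesically_convex P" and \<alpha>: "geodesic_param \<alpha>"
    and L: "\<And>k. k < n \<Longrightarrow> geodesic_line (L k) \<and> polygon_side n v k \<subseteq> L k"
    and i: "i < n" "L i = range \<alpha>" "polygon_side n v i = geodesic_segment (\<alpha> a) (\<alpha> b)" "a < b"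
    and j: "j < n" "\<alpha> c \<in> polygon_side n v j" "b < c"
  shows False
proof -
  have fr: "frontier P = (\<Union>k<n. polygon_side n v k)" and "compact P"
    using poly by (simp_all add: polygon_def)
  hence cP: "closed P" by (simp add: compact_imp_closed)
  have sP: "polygon_side n v k \<subseteq> P" if "k < n" for k
  proof -
    have "frontier P \<subseteq> P" using cP by (simp add: frontier_subset_eq)
    thus ?thesis using that fr by blast
  qed
  have on_i: "\<alpha> t \<in> polygon_side n v i \<longleftrightarrow> a \<le> t \<and> t \<le> b" for t
    using geodesic_param_in_segment_iff[OF \<alpha>] i(3,4) by simp
  have inj: "\<alpha> s \<noteq> \<alpha> t" if "s \<noteq> t" for s t
    using \<alpha> that unfolding geodesic_param_def by (metis abs_eq_0 dist_self right_minus_eq)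
  \<comment> \<open>A side missing \<open>\<alpha> b\<close> is closed and stays away from it; a
    side other than \<open>i\<close> through \<open>\<alpha> b\<close> is adjacent, and meeting the
    line again would put both on one line.\<close>
  have avoid: "\<exists>u>b. \<forall>t>b. t < u \<longrightarrow> \<alpha> t \<notin> polygon_side n v k" if k: "k < n" for k
  proof (cases "\<alpha> b \<in> polygon_side n v k")
    case False
    have "open (- polygon_side n v k)"
      by (simp add: polygon_side_def closed_geodesic_segment open_Compl)
    then obtain e where e: "e > 0" "ball (\<alpha> b) e \<subseteq> - polygon_side n v k"
      using False by (meson ComplI open_contains_ball)
    have "\<alpha> t \<notin> polygon_side n v k" if "t > b" "t < b + e" for t
    proof -
      have "\<alpha> t \<in> ball (\<alpha> b) e" using \<alpha> that by (simp add: geodesic_param_def)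
      thus ?thesis using e(2) by blast
    qed
    thus ?thesis using e(1) by (intro exI[of _ "b + e"]) simp
  next
    case True
    show ?thesis
    proof (cases "k = i")
      case True
      thus ?thesis by (intro exI[of _ "b + 1"]) (simp add: on_i)
    next
      case False
      have "\<alpha> b \<in> polygon_side n v i \<inter> polygon_side n v k" using True on_i i(4) by simp
      hence adj: "k = Suc i mod n \<or> i = Suc k mod n"
        using polygon_nonadjacent_sides[OF poly i(1) k False] by blast
      have "\<alpha> t \<notin> polygon_side n v k" if "t > b" for t
      proof
        assume t: "\<alpha> t \<in> polygon_side n v k"
        obtain \<beta> where \<beta>: "geodesic_param \<beta>" "L k = range \<beta>"
          using L[OF k] unfolding geodesic_line_def by blast
        have "\<alpha> b \<in> L k" "\<alpha> t \<in> L k" using L[OF k] t True by auto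
        hence "range \<alpha> = range \<beta>"
          using inj[of b t] that by (intro geodesic_range_eq[OF \<alpha> \<beta>(1), of "\<alpha> b" "\<alpha> t"]) (auto simp: \<beta>(2))
        hence "polygon_side n v k \<subseteq> L i" using L[OF k] i(2) \<beta>(2) by simp
        thus False using polygon_adjacent_sides[OF poly i(1) k adj] L[OF i(1)] by blast
      qed
      thus ?thesis by (intro exI[of _ "b + 1"]) simp
    qed
  qed
  have "eventually (\<lambda>t. \<forall>k\<in>{..<n}. \<alpha> t \<notin> polygon_side n v k) (at_right b)"
    using avoid by (intro eventually_ball_finite) (auto simp: eventually_at_right_field)
  moreover have "eventually (\<lambda>t. t < c) (at_right b)" "eventually (\<lambda>t. t > b) (at_right b)"
    using j(3) by (auto simp: eventually_at_right_field)
  ultimately have "eventually (\<lambda>t. (\<forall>k\<in>{..<n}. \<alpha> t \<notin> polygon_side n v k) \<and> t < c \<and> t > b) (at_right b)"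
    by eventually_elim auto
  then obtain t where t: "\<And>k. k < n \<Longrightarrow> \<alpha> t \<notin> polygon_side n v k" "b < t" "t < c"
    using eventually_happens'[OF trivial_limit_at_right_real] by (metis (mono_tags, lifting) lessThan_iff)
  have inP: "\<alpha> a \<in> P" "\<alpha> b \<in> P" "\<alpha> c \<in> P"
    using sP i(1) j(1,2) on_i i(4) by (auto simp: subset_iff)
  have "\<alpha> t \<in> geodesic_segment (\<alpha> b) (\<alpha> c)"
    using geodesic_param_in_segment_iff[OF \<alpha>, of b c t] t by simp
  hence "\<alpha> t \<in> P" using conv inP unfolding geodesically_convex_def by blast
  moreover have "\<alpha> t \<notin> frontier P" using t(1) fr by auto
  ultimately have int: "\<alpha> t \<in> interior P"
    using closure_subset by (auto simp: frontier_def)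
  have "\<alpha> ((a + b) / 2) \<in> interior P"
    using i(4) t(2) by (intro geodesically_convex_interior[OF conv \<alpha> inP(1) int]) auto
  moreover have "\<alpha> ((a + b) / 2) \<in> frontier P"
    using on_i[of "(a + b) / 2"] i(1,4) fr by auto
  ultimately show False by (simp add: frontier_def)
qed

text \<open>Adjacent sides span different lines by definition. Nonadjacent sides on one line would
  be disjoint intervals of it, and neither order of them is possible.\<close>

lemma convex_polygon_distinct_lines:
  assumes poly: "polygon n v P" and conv: "geodesically_convex P"
    and L: "\<And>k. k < n \<Longrightarrow> geodesic_line (L k) \<and> polygon_side n v k \<subseteq> L k"
    and ij: "i < n" "j < n" "i \<noteq> j"
  shows "L i \<noteq> L j"
proof
  assume eq: "L i = L j"
  have "\<not> (j = Suc i mod n \<or> i = Suc j mod n)"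
    using polygon_adjacent_sides[OF poly ij(1,2)] L[OF ij(1)] L[OF ij(2)] eq by metis
  hence disj: "polygon_side n v i \<inter> polygon_side n v j = {}"
    using polygon_nonadjacent_sides[OF poly ij(1,2)] ij(3) by blast
  obtain \<alpha> where \<alpha>: "geodesic_param \<alpha>" "L i = range \<alpha>" using L[OF ij(1)] unfolding geodesic_line_def by blast
  have ends: "\<exists>a b. a < b \<and> polygon_side n v k = geodesic_segment (\<alpha> a) (\<alpha> b)" if k: "k < n" "L k = range \<alpha>" for k
  proof -
    have n: "n \<ge> 3" "inj_on v {..<n}" using poly by (auto simp: polygon_def)
    have "Suc k mod n \<noteq> k" using k(1) n(1) by (cases "Suc k = n") auto
    hence vk: "v k \<noteq> v (Suc k mod n)"
      using n k(1) inj_onD[OF n(2), of k "Suc k mod n"] by auto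
    have "v k \<in> range \<alpha>" "v (Suc k mod n) \<in> range \<alpha>"
      using L[OF k(1)] k(2) geodesic_segment_ends unfolding polygon_side_def by blast+
    then obtain a b where ab: "v k = \<alpha> a" "v (Suc k mod n) = \<alpha> b" by blast
    hence "a \<noteq> b" using vk by auto
    thus ?thesis
      using ab geodesic_segment_commute[of "\<alpha> a" "\<alpha> b"] unfolding polygon_side_def by (metis linorder_neqE_linordered_idom)
  qed
  obtain a b where ab: "a < b" "polygon_side n v i = geodesic_segment (\<alpha> a) (\<alpha> b)"
    using ends ij(1) \<alpha>(2) by blast
  obtain c d where cd: "c < d" "polygon_side n v j = geodesic_segment (\<alpha> c) (\<alpha> d)"
    using ends ij(2) \<alpha>(2) eq by metis
  have on: "\<alpha> t \<in> polygon_side n v i \<longleftrightarrow> a \<le> t \<and> t \<le> b" "\<alpha> t \<in> polygon_side n v j \<longleftrightarrow> c \<le> t \<and> t \<le> d" for t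
    using geodesic_param_in_segment_iff[OF \<alpha>(1)] ab cd by simp_all
  have "b < c \<or> d < a"
  proof (rule ccontr)
    assume "\<not> ?thesis"
    hence "\<alpha> (max a c) \<in> polygon_side n v i \<inter> polygon_side n v j" using ab(1) cd(1) by (auto simp: on)
    thus False using disj by simp
  qed
  thus False
  proof
    assume "b < c"
    thus False
      using polygon_sides_not_ordered_on_line[OF poly conv \<alpha>(1) L ij(1) \<alpha>(2) ab(2,1) ij(2), of c] on cd(1) by simp
  next
    assume "d < a"
    thus False
      using polygon_sides_not_ordered_on_line[OF poly conv \<alpha>(1) L ij(2) _ cd(2,1) ij(1), of a] on ab(1) \<alpha>(2) eq by simp
  qed
qed

text \<open>The projection \<open>f\<close> telescopes over the other sides from one end of side
  \<open>i\<close> to the other; the two neighbours have a vertex on \<open>L i\<close>, whence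
  their better bound.\<close>

lemma (in oriented_surface) side_length_less:
  assumes cg: "closed_geodesic \<Gamma> l \<gamma>" and n: "n \<ge> 3" and i: "i < n"
    and L: "\<And>k. k < n \<Longrightarrow> line_above \<Gamma> \<gamma> (L k) \<and> polygon_side n v k \<subseteq> L k"
    and distinct: "\<And>j. j < n \<Longrightarrow> j \<noteq> i \<Longrightarrow> L j \<noteq> L i"
  shows "side_length n v i < (real n - 2) * l"
proof -
  obtain f where f: "(\<forall>x\<in>L i. \<forall>y\<in>L i. \<bar>f x - f y\<bar> = dist x y) \<and>
    (\<forall>\<Lambda>'. line_above \<Gamma> \<gamma> \<Lambda>' \<and> \<Lambda>' \<noteq> L i \<longrightarrow> (\<forall>x\<in>\<Lambda>'. \<forall>y\<in>\<Lambda>'. \<bar>f x - f y\<bar> < l \<and> 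
      (x \<in> L i \<longrightarrow> \<bar>f x - f y\<bar> < l / 2)))"
    using ex_line_above_projection[OF cg conjunct1[OF L[OF i]]] by (rule exE)
  have f1: "\<bar>f x - f y\<bar> = dist x y" if "x \<in> L i" "y \<in> L i" for x y
    using f that by simp
  have f2: "\<bar>f x - f y\<bar> < l" "x \<in> L i \<longrightarrow> \<bar>f x - f y\<bar> < l / 2"
    if "line_above \<Gamma> \<gamma> \<Lambda>' \<and> \<Lambda>' \<noteq> L i" "x \<in> \<Lambda>'" "y \<in> \<Lambda>'" for \<Lambda>' x y
    using conjunct2[OF f] that by simp_all
  \<comment> \<open>Cyclic renumbering: side \<open>i\<close> runs from \<open>u 0\<close> to
    \<open>u 1\<close>, and the other sides lead from \<open>u 1\<close> on to
    \<open>u n = u 0\<close>.\<close>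
  define u where "u k = v ((i + k) mod n)" for k
  define a where "a k = \<bar>f (u (Suc k)) - f (u k)\<bar>" for k
  have side: "u k \<in> L ((i + k) mod n)" "u (Suc k) \<in> L ((i + k) mod n)" for k
  proof -
    have "(i + k) mod n < n" using n by simp
    moreover have "u k \<in> polygon_side n v ((i + k) mod n)" "u (Suc k) \<in> polygon_side n v ((i + k) mod n)"
      using geodesic_segment_ends by (simp_all add: polygon_side_def u_def mod_Suc_eq)
    ultimately show "u k \<in> L ((i + k) mod n)" "u (Suc k) \<in> L ((i + k) mod n)" using L[of "(i + k) mod n"] by auto
  qed
  have other: "line_above \<Gamma> \<gamma> (L ((i + k) mod n)) \<and> L ((i + k) mod n) \<noteq> L i" if "0 < k" "k < n" for k
  proof -
    have "(i + k) mod n \<noteq> i"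
      using that i by (cases "i + k < n") (auto simp: mod_if)
    thus ?thesis using L[of "(i + k) mod n"] distinct[of "(i + k) mod n"] n by simp
  qed
  have u01: "u 0 \<in> L i" "u 1 \<in> L i" and un: "u n = u 0"
    using side[of 0] i by (simp_all add: u_def)
  have "side_length n v i = \<bar>f (u n) - f (u 1)\<bar>"
    using f1[OF u01] i by (simp add: side_length_def u_def un[unfolded u_def])
  also have "\<dots> \<le> (\<Sum>k\<in>{1..<n}. a k)"
  proof -
    have "f (u n) - f (u 1) = (\<Sum>k\<in>{1..<n}. f (u (Suc k)) - f (u k))"
      using sum_Suc_diff'[of 1 n "\<lambda>k. f (u k)"] n by simp
    thus ?thesis unfolding a_def by (simp only:) (rule sum_abs)
  qed
  also have "\<dots> = a 1 + (\<Sum>k\<in>{2..<n-1}. a k) + a (n - 1)"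
  proof -
    have "(\<Sum>k\<in>{1..<n}. a k) = (\<Sum>k\<in>{1..<n-1}. a k) + a (n - 1)"
      using n sum.atLeastLessThan_Suc[of 1 "n - 1" a] by simp
    also have "(\<Sum>k\<in>{1..<n-1}. a k) = a 1 + (\<Sum>k\<in>{2..<n-1}. a k)"
      using n sum.atLeast_Suc_lessThan[of 1 "n - 1" a] by (simp add: numeral_2_eq_2)
    finally show ?thesis .
  qed
  also have "\<dots> < l / 2 + real (n - 3) * l + l / 2"
  proof -
    have "a 1 < l / 2"
      unfolding a_def using f2(2)[OF other[of 1] side(1)[of 1] side(2)[of 1]] u01 n by (simp add: abs_minus_commute)
    \<comment> \<open>Here the vertex on \<open>L i\<close> is the later end \<open>u n\<close>, so
      the ends are exchanged.\<close>
    moreover have "a (n - 1) < l / 2"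
      unfolding a_def using f2(2)[OF other[of "n - 1"] side(2)[of "n - 1"] side(1)[of "n - 1"]] u01 un n by simp
    \<comment> \<open>This range is empty for \<open>n = 3\<close>; the strictness of the total
      comes from the two neighbours.\<close>
    moreover have "(\<Sum>k\<in>{2..<n-1}. a k) \<le> (\<Sum>k\<in>{2..<n-1}. l)"
    proof (intro sum_mono)
      fix k assume "k \<in> {2..<n-1}"
      hence "0 < k" "k < n" by auto
      from f2(1)[OF other[OF this] side(2,1)] show "a k \<le> l" unfolding a_def by linarith
    qed
    moreover have "(\<Sum>k\<in>{2..<n-1}. l) = real (n - 3) * l" by (simp add: numeral_3_eq_3)
    ultimately show ?thesis by linarith
  qed
  also have "\<dots> = (real n - 2) * l" using n by (simp add: of_nat_diff algebra_simps)
  finally show ?thesis .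
qed

lemma line_above_imp_geodesic_line: "line_above \<Gamma> \<gamma> \<Lambda> \<Longrightarrow> geodesic_line \<Lambda>"
  unfolding line_above_def geodesic_line_def by blast

theorem corollary5p3:
  fixes \<Gamma> :: "(hyp_plane \<Rightarrow> hyp_plane) set"
    and \<gamma> :: "real \<Rightarrow> hyp_plane set"
    and l :: real
  assumes "surface_group \<Gamma>"
    and "orientable_quotient \<Gamma>"
    and "closed_geodesic \<Gamma> l \<gamma>"
  shows "(\<forall>v P. polygon_formed_by_lines_above \<Gamma> \<gamma> 3 v P \<longrightarrow>
            (\<forall>i<3. side_length 3 v i < l)) \<and>
         (\<forall>n\<ge>3. \<forall>v P. polygon_formed_by_lines_above \<Gamma> \<gamma> n v P \<and> geodesically_convex P \<longrightarrow>
            (\<forall>i<n. side_length n v i < (real n - 2) * l))"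
proof (intro conjI allI impI)
  interpret oriented_surface \<Gamma> by unfold_locales (fact assms)+
  fix v P and i :: nat
  assume h: "polygon_formed_by_lines_above \<Gamma> \<gamma> 3 v P" and i: "i < 3"
  hence poly: "polygon 3 v P" by (simp add: polygon_formed_by_lines_above_def)
  obtain L where L: "\<And>k. k < 3 \<Longrightarrow> line_above \<Gamma> \<gamma> (L k) \<and> polygon_side 3 v k \<subseteq> L k"
    using h unfolding polygon_formed_by_lines_above_def by metis
  have "L j \<noteq> L i" if j: "j < 3" "j \<noteq> i" for j
  proof
    assume eq: "L j = L i"
    \<comment> \<open>Any two sides of a triangle are adjacent, so the corner condition separates
      their lines.\<close>
    have "j = Suc i mod 3 \<or> i = Suc j mod 3" using i j by (auto simp: mod_Suc)
    thus False
      using polygon_adjacent_sides[OF poly i j(1) _ line_above_imp_geodesic_line[OF conjunct1[OF L[OF i]]]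
          conjunct2[OF L[OF i]]] conjunct2[OF L[OF j(1)]] eq by simp
  qed
  from side_length_less[OF assms(3) order.refl i L this] show "side_length 3 v i < l" by simp
next
  interpret oriented_surface \<Gamma> by unfold_locales (fact assms)+
  fix n :: nat and v P and i :: nat
  assume n: "n \<ge> 3" and i: "i < n"
  assume "polygon_formed_by_lines_above \<Gamma> \<gamma> n v P \<and> geodesically_convex P"
  hence h: "polygon_formed_by_lines_above \<Gamma> \<gamma> n v P" and conv: "geodesically_convex P" by auto
  have poly: "polygon n v P" using h by (simp add: polygon_formed_by_lines_above_def)
  obtain L where L: "\<And>k. k < n \<Longrightarrow> line_above \<Gamma> \<gamma> (L k) \<and> polygon_side n v k \<subseteq> L k"
    using h unfolding polygon_formed_by_lines_above_def by metis
  have "L j \<noteq> L i" if "j < n" "j \<noteq> i" for j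
    using that i L line_above_imp_geodesic_line by (intro convex_polygon_distinct_lines[OF poly conv]) blast+
  from side_length_less[OF assms(3) n i L this] show "side_length n v i < (real n - 2) * l" .
qed

end
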